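(* The axiom scheme $\mathsf{ETR}$ (effective transfinite recursion) is provable in $\mathsf{ACA}_0$. That is, for all $\Sigma^0_1$ formulas $\varphi$ and $\psi$, $\mathsf{ACA}_0$ proves $$\forall X\,\Big[\big(WO(X)\wedge\forall Y\,\forall n\,(\varphi(n,Y)\leftrightarrow\neg\psi(n,Y))\big)\rightarrow\exists Y\,H_\varphi(X,Y)\Big].$$
   Context: $LO(X)$ and $WO(X)$ are the standard formulas of second order arithmetic saying that $X$ is a linear order, respectively a well order; $x\in X$ abbreviates $x\in\mathrm{field}(X)$, and $<_X$ is the strict order of $X$. For a formula $\varphi(n,Y)$, $H_\varphi(X,Y)$ is the formula stating that $LO(X)$ and $$Y=\{\langle n,j\rangle: j\in X\wedge\varphi(n,Y^j)\},$$ where $Y^j=\{\langle m,a\rangle: a<_Xj\wedge\langle m,a\rangle\in Y\}$. $\mathsf{ETR}$ is the scheme displayed in the claim, with $\varphi$ and $\psi$ ranging over $\Sigma^0_1$ formulas (possibly with parameters). *)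

theory Defs
  imports Main
begin

section \<open>The language of second order arithmetic\<close>

text \<open>
  Formulas are two-sorted, with separate de Bruijn indices for number variables and for set
  variables: \<open>AllN\<close> binds number variable 0 and \<open>AllS\<close> binds set variable 0 of its body.
  As usual, equality is primitive for numbers only; equality of sets is extensional.
\<close>

datatype tm = Var nat | Zero | One | Add tm tm | Mul tm tm

datatype fm =
    Bot
  | Eq tm tm
  | Less tm tm
  | Mem tm nat
  | Imp fm fm
  | AllN fm
  | AllS fm

abbreviation Neg :: "fm \<Rightarrow> fm" where "Neg A \<equiv> Imp A Bot"
abbreviation Or :: "fm \<Rightarrow> fm \<Rightarrow> fm" where "Or A B \<equiv> Imp (Neg A) B"
abbreviation And :: "fm \<Rightarrow> fm \<Rightarrow> fm" where "And A B \<equiv> Neg (Imp A (Neg B))"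
abbreviation Iff :: "fm \<Rightarrow> fm \<Rightarrow> fm" where "Iff A B \<equiv> And (Imp A B) (Imp B A)"
abbreviation ExN :: "fm \<Rightarrow> fm" where "ExN A \<equiv> Neg (AllN (Neg A))"
abbreviation ExS :: "fm \<Rightarrow> fm" where "ExS A \<equiv> Neg (AllS (Neg A))"

text \<open>
  Simultaneous capture-avoiding substitution of terms for number variables and of set
  variables for set variables.
\<close>

primrec subst_tm :: "(nat \<Rightarrow> tm) \<Rightarrow> tm \<Rightarrow> tm" where
  "subst_tm \<sigma> (Var i) = \<sigma> i"
| "subst_tm \<sigma> Zero = Zero"
| "subst_tm \<sigma> One = One"
| "subst_tm \<sigma> (Add s t) = Add (subst_tm \<sigma> s) (subst_tm \<sigma> t)"
| "subst_tm \<sigma> (Mul s t) = Mul (subst_tm \<sigma> s) (subst_tm \<sigma> t)"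

definition lift_tm :: "tm \<Rightarrow> tm" where
  "lift_tm = subst_tm (\<lambda>i. Var (Suc i))"

primrec subst :: "(nat \<Rightarrow> tm) \<Rightarrow> (nat \<Rightarrow> nat) \<Rightarrow> fm \<Rightarrow> fm" where
  "subst \<sigma> \<rho> Bot = Bot"
| "subst \<sigma> \<rho> (Eq s t) = Eq (subst_tm \<sigma> s) (subst_tm \<sigma> t)"
| "subst \<sigma> \<rho> (Less s t) = Less (subst_tm \<sigma> s) (subst_tm \<sigma> t)"
| "subst \<sigma> \<rho> (Mem t X) = Mem (subst_tm \<sigma> t) (\<rho> X)"
| "subst \<sigma> \<rho> (Imp A B) = Imp (subst \<sigma> \<rho> A) (subst \<sigma> \<rho> B)"
| "subst \<sigma> \<rho> (AllN A) = AllN (subst (case_nat (Var 0) (\<lambda>i. lift_tm (\<sigma> i))) \<rho> A)"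
| "subst \<sigma> \<rho> (AllS A) = AllS (subst \<sigma> (case_nat 0 (\<lambda>i. Suc (\<rho> i))) A)"

definition liftN :: "fm \<Rightarrow> fm" where
  "liftN = subst (\<lambda>i. Var (Suc i)) id"

definition liftS :: "fm \<Rightarrow> fm" where
  "liftS = subst Var Suc"

definition instN :: "tm \<Rightarrow> fm \<Rightarrow> fm" where
  "instN t = subst (case_nat t Var) id"

definition instS :: "nat \<Rightarrow> fm \<Rightarrow> fm" where
  "instS X = subst Var (case_nat X id)"


section \<open>Provability\<close>

text \<open>
  Classical natural deduction for two-sorted first order logic with equality.  Axioms in \<open>T\<close>
  may have free variables and stand for their universal closures; so they are available under
  every context, and are not lifted in the introduction rules for the quantifiers, while the
  side hypotheses \<open>\<Gamma>\<close> are (this is the eigenvariable condition).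
\<close>

inductive deriv :: "fm set \<Rightarrow> fm list \<Rightarrow> fm \<Rightarrow> bool" for T :: "fm set" where
  Ax: "A \<in> T \<Longrightarrow> deriv T \<Gamma> A"
| Hyp: "A \<in> set \<Gamma> \<Longrightarrow> deriv T \<Gamma> A"
| ImpI: "deriv T (A # \<Gamma>) B \<Longrightarrow> deriv T \<Gamma> (Imp A B)"
| ImpE: "deriv T \<Gamma> (Imp A B) \<Longrightarrow> deriv T \<Gamma> A \<Longrightarrow> deriv T \<Gamma> B"
| Raa: "deriv T (Neg A # \<Gamma>) Bot \<Longrightarrow> deriv T \<Gamma> A"
| AllNI: "deriv T (map liftN \<Gamma>) A \<Longrightarrow> deriv T \<Gamma> (AllN A)"
| AllNE: "deriv T \<Gamma> (AllN A) \<Longrightarrow> deriv T \<Gamma> (instN t A)"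
| AllSI: "deriv T (map liftS \<Gamma>) A \<Longrightarrow> deriv T \<Gamma> (AllS A)"
| AllSE: "deriv T \<Gamma> (AllS A) \<Longrightarrow> deriv T \<Gamma> (instS X A)"
| EqRefl: "deriv T \<Gamma> (Eq t t)"
| EqSubst: "deriv T \<Gamma> (Eq s t) \<Longrightarrow> deriv T \<Gamma> (instN s A) \<Longrightarrow> deriv T \<Gamma> (instN t A)"

definition proves :: "fm set \<Rightarrow> fm \<Rightarrow> bool" (infix "\<turnstile>" 50) where
  "T \<turnstile> A \<longleftrightarrow> deriv T [] A"


section \<open>Classes of formulas\<close>

inductive Delta00 :: "fm \<Rightarrow> bool" where
  "Delta00 Bot"
| "Delta00 (Eq s t)"
| "Delta00 (Less s t)"
| "Delta00 (Mem t X)"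
| "Delta00 A \<Longrightarrow> Delta00 B \<Longrightarrow> Delta00 (Imp A B)"
| "Delta00 A \<Longrightarrow> Delta00 (AllN (Imp (Less (Var 0) (lift_tm t)) A))"
| "Delta00 A \<Longrightarrow> Delta00 (ExN (And (Less (Var 0) (lift_tm t)) A))"

definition Sigma01 :: "fm \<Rightarrow> bool" where
  "Sigma01 A \<longleftrightarrow> (\<exists>B. Delta00 B \<and> A = ExN B)"

primrec arithmetical :: "fm \<Rightarrow> bool" where
  "arithmetical Bot = True"
| "arithmetical (Eq s t) = True"
| "arithmetical (Less s t) = True"
| "arithmetical (Mem t X) = True"
| "arithmetical (Imp A B) = (arithmetical A \<and> arithmetical B)"
| "arithmetical (AllN A) = arithmetical A"
| "arithmetical (AllS A) = False"


section \<open>The system of arithmetical comprehension\<close>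

definition basic_axioms :: "fm set" where
  "basic_axioms = (let m = Var 0; n = Var 1 in
    {Neg (Eq (Add m One) Zero),
     Imp (Eq (Add m One) (Add n One)) (Eq m n),
     Eq (Add m Zero) m,
     Eq (Add m (Add n One)) (Add (Add m n) One),
     Eq (Mul m Zero) Zero,
     Eq (Mul m (Add n One)) (Add (Mul m n) m),
     Neg (Less m Zero),
     Iff (Less m (Add n One)) (Or (Less m n) (Eq m n))})"

definition induction_axiom :: fm where
  "induction_axiom =
     Imp (And (Mem Zero 0) (AllN (Imp (Mem (Var 0) 0) (Mem (Add (Var 0) One) 0))))
         (AllN (Mem (Var 0) 0))"

text \<open>\<open>liftS\<close> makes sure that the set being defined does not occur in the defining formula.\<close>

definition comprehension :: "fm \<Rightarrow> fm" where
  "comprehension A = ExS (AllN (Iff (Mem (Var 0) 0) (liftS A)))"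

definition ACA0 :: "fm set" where
  "ACA0 = basic_axioms \<union> {induction_axiom} \<union> {comprehension A | A. arithmetical A}"


section \<open>Linear orders and well orders\<close>

text \<open>
  Pairs are coded by \<open>\<langle>i, j\<rangle> = (i + j)\<^sup>2 + i\<close>.  Linear orders are reflexive relations, given as
  sets of pairs; hence the field of \<open>X\<close> is the set of all \<open>i\<close> with \<open>\<langle>i, i\<rangle> \<in> X\<close>.
\<close>

definition pair :: "tm \<Rightarrow> tm \<Rightarrow> tm" where
  "pair s t = Add (Mul (Add s t) (Add s t)) s"

definition le_in :: "nat \<Rightarrow> tm \<Rightarrow> tm \<Rightarrow> fm" where
  "le_in X s t = Mem (pair s t) X"

definition less_in :: "nat \<Rightarrow> tm \<Rightarrow> tm \<Rightarrow> fm" where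
  "less_in X s t = And (le_in X s t) (Neg (le_in X t s))"

definition in_field :: "nat \<Rightarrow> tm \<Rightarrow> fm" where
  "in_field X t = Mem (pair t t) X"

definition is_relation :: "nat \<Rightarrow> fm" where
  "is_relation X = AllN (Imp (Mem (Var 0) X) (ExN (ExN (Eq (Var 2) (pair (Var 1) (Var 0))))))"

definition LO :: "nat \<Rightarrow> fm" where
  "LO X = (let i = Var 2; j = Var 1; k = Var 0 in
     And (is_relation X) (AllN (AllN (AllN
      (And (Imp (le_in X i j) (And (in_field X i) (in_field X j)))
      (And (Imp (And (le_in X i j) (le_in X j k)) (le_in X i k))
      (And (Imp (And (le_in X i j) (le_in X j i)) (Eq i j))
           (Imp (And (in_field X i) (in_field X j)) (Or (le_in X i j) (le_in X j i))))))))))"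

text \<open>\<open>F\<close> is (the graph of) a function from the natural numbers to the natural numbers.\<close>

definition is_function :: "nat \<Rightarrow> fm" where
  "is_function F =
     And (is_relation F)
    (And (AllN (ExN (Mem (pair (Var 1) (Var 0)) F)))
         (AllN (AllN (AllN
           (Imp (And (Mem (pair (Var 2) (Var 1)) F) (Mem (pair (Var 2) (Var 0)) F))
                (Eq (Var 1) (Var 0)))))))"

text \<open>\<open>F\<close> is a descending sequence: \<open>F(n + 1) <\<^sub>X F(n)\<close> for all \<open>n\<close>.\<close>

definition descending :: "nat \<Rightarrow> nat \<Rightarrow> fm" where
  "descending X F =
     And (is_function F)
         (AllN (AllN (AllN
           (let n = Var 2; a = Var 1; b = Var 0 in
            Imp (And (Mem (pair n a) F) (Mem (pair (Add n One) b) F)) (less_in X b a)))))"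

definition WO :: "nat \<Rightarrow> fm" where
  "WO X = And (LO X) (Neg (ExS (descending (Suc X) 0)))"


section \<open>Effective transfinite recursion\<close>

text \<open>\<open>Z\<close> is the set \<open>Y\<^sup>j = {\<langle>m, a\<rangle>. a <\<^sub>X j \<and> \<langle>m, a\<rangle> \<in> Y}\<close>.\<close>

definition is_section :: "nat \<Rightarrow> nat \<Rightarrow> tm \<Rightarrow> nat \<Rightarrow> fm" where
  "is_section X Y j Z =
     AllN (Iff (Mem (Var 0) Z)
       (ExN (ExN
         (let z = Var 2; m = Var 1; a = Var 0; j' = lift_tm (lift_tm (lift_tm j)) in
          And (Eq z (pair m a)) (And (less_in X a j') (Mem (pair m a) Y))))))"

text \<open>
  A formula \<open>\<phi>(n, Y)\<close> is given with \<open>n\<close> as number variable 0, \<open>Y\<close> as set variable 0 and the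
  order \<open>X\<close> as set variable 1; all the other variables are parameters.
  \<open>H \<phi>\<close> is the formula \<open>H\<^sub>\<phi>(X, Y)\<close> with \<open>X\<close> as set variable 1 and \<open>Y\<close> as set variable 0, where
  \<open>\<phi>(n, Y\<^sup>j)\<close> is read as \<open>\<exists>Z. Z = Y\<^sup>j \<and> \<phi>(n, Z)\<close>.  In the scope of the quantifiers over
  \<open>z\<close>, \<open>n\<close>, \<open>j\<close> and \<open>Z\<close>, the set variables 0, 1, 2 are \<open>Z\<close>, \<open>Y\<close>, \<open>X\<close>.
\<close>

definition H :: "fm \<Rightarrow> fm" where
  "H \<phi> =
     And (LO 1)
         (AllN (Iff (Mem (Var 0) 0)
           (ExN (ExN
             (let z = Var 2; n = Var 1; j = Var 0;
                  \<phi>nZ = subst (case_nat n (\<lambda>i. Var (i + 3))) (case_nat 0 (\<lambda>i. i + 2)) \<phi> in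
              And (Eq z (pair n j))
             (And (in_field 1 j)
                  (ExS (And (is_section 2 1 j 0) \<phi>nZ))))))))"

definition ETR :: "fm \<Rightarrow> fm \<Rightarrow> fm" where
  "ETR \<phi> \<psi> =
     AllS (Imp (And (WO 0) (AllS (AllN (Iff \<phi> (Neg \<psi>))))) (ExS (H \<phi>)))"

end

theory Submission
  imports Defs "HOL-Library.Countable_Set"
begin

text \<open>
  By completeness it is enough to argue inside an arbitrary countable model of \<open>ACA\<^sub>0\<close>.
  There the recursion is computed by finite certificates: a certificate decides
  \<open>\<langle>n, j\<rangle>\<close> by exhibiting a witness for \<open>\<phi>(n, Y\<^sup>j)\<close> or for \<open>\<psi>(n, Y\<^sup>j)\<close>, and
  it also decides the finitely many pairs below \<open>j\<close> on which the witness depends.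
  By transfinite induction any two certificates agree and every pair has a certificate; the
  induction statements are arithmetical, since bounded sets are coded by numbers.  Hence the set of
  all positively certified pairs exists by arithmetical comprehension, and it is the desired \<open>Y\<close>.
\<close>


section \<open>Completeness\<close>

text \<open>The obstacle is that \<open>WO\<close> yields transfinite induction only for
  arithmetical predicates, whereas the usual induction statement, that some set obeys the recursion
  up to j, quantifies over sets. The formula \<psi> removes this quantifier: a negative answer, too,
  has a number as witness, and either kind of witness reads its oracle only below the value of a
  term. The model may be nonstandard, so "finite" always means bounded inside the model: products,
  unions and sequences have to be built by internal induction. Each such induction and each
  comprehension requires its predicate to be definable; \<open>adef\<close> reduces this to applying
  introduction rules to HOL predicates. Countability of the model enters here, since it gives every
  element its own number variable as a parameter.\<close>

lemma subst_tm_subst_tm: "subst_tm \<sigma> (subst_tm \<tau> t) = subst_tm (\<lambda>i. subst_tm \<sigma> (\<tau> i)) t"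
  by (induction t) auto

lemma subst_tm_Var [simp]: "subst_tm Var t = t"
  by (induction t) auto

lemma lift_tm_Var [simp]: "lift_tm (Var i) = Var (Suc i)"
  by (simp add: lift_tm_def)

lemma case_nat_lift_lift:
  "subst_tm (case_nat s (\<lambda>i. lift_tm (\<sigma> i))) (lift_tm t) = lift_tm (subst_tm \<sigma> t)"
  by (simp add: lift_tm_def subst_tm_subst_tm)

lemma subst_tm_case_lift [simp]: "subst_tm (case_nat s \<sigma>) (lift_tm t) = subst_tm \<sigma> t"
  by (simp add: lift_tm_def subst_tm_subst_tm)

lemma subst_subst:
  "subst \<sigma> \<rho> (subst \<tau> \<pi> A) = subst (\<lambda>i. subst_tm \<sigma> (\<tau> i)) (\<lambda>i. \<rho> (\<pi> i)) A"
proof (induction A arbitrary: \<sigma> \<rho> \<tau> \<pi>)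
  case (AllN A)
  have "(\<lambda>i. subst_tm (case_nat (Var 0) (\<lambda>i. lift_tm (\<sigma> i))) (case_nat (Var 0) (\<lambda>i. lift_tm (\<tau> i)) i))
      = case_nat (Var 0) (\<lambda>i. lift_tm (subst_tm \<sigma> (\<tau> i)))"
    by (auto simp: fun_eq_iff case_nat_lift_lift simp del: subst_tm_case_lift split: nat.split)
  then show ?case by (simp add: AllN)
next
  case (AllS A)
  have "(\<lambda>i. case_nat 0 (\<lambda>i. Suc (\<rho> i)) (case_nat 0 (\<lambda>i. Suc (\<pi> i)) i))
      = case_nat 0 (\<lambda>i. Suc (\<rho> (\<pi> i)))"
    by (auto simp: fun_eq_iff split: nat.split)
  then show ?case by (simp add: AllS)
qed (auto simp: subst_tm_subst_tm)

lemma case_nat_Var [simp]: "case_nat (Var 0) (\<lambda>i. Var (Suc i)) = Var"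
  by (auto simp: fun_eq_iff split: nat.split)

lemma case_nat_Suc_id: "case_nat 0 (\<lambda>i. Suc (id i)) = id"
  by (auto simp: fun_eq_iff split: nat.split)

lemma subst_Var [simp]: "subst Var id A = A"
proof (induction A)
  case (AllS A)
  then show ?case by (simp only: subst.simps case_nat_Suc_id)
qed auto

text \<open>Fuses an instantiation with a substitution that was pushed under the quantifier. The
  quantifier cases of \<open>proves_substN\<close> and of the truth lemma in
  \<open>completeness\<close> rest on this form; \<open>instS_subst\<close> is the counterpart for
  sets.\<close>

lemma instN_subst:
  "instN t (subst (case_nat (Var 0) (\<lambda>i. lift_tm (\<sigma> i))) \<rho> A) = subst (case_nat t \<sigma>) \<rho> A"
proof -
  have "(\<lambda>i. subst_tm (case_nat t Var) (case_nat (Var 0) (\<lambda>i. lift_tm (\<sigma> i)) i)) = case_nat t \<sigma>"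
    by (auto simp: fun_eq_iff split: nat.split)
  then show ?thesis by (simp add: instN_def subst_subst)
qed

lemma instS_subst:
  "instS X (subst \<sigma> (case_nat 0 (\<lambda>i. Suc (\<rho> i))) A) = subst \<sigma> (case_nat X \<rho>) A"
proof -
  have "(\<lambda>i. case_nat X id (case_nat 0 (\<lambda>i. Suc (\<rho> i)) i)) = case_nat X \<rho>"
    by (auto simp: fun_eq_iff split: nat.split)
  then show ?thesis by (simp add: instS_def subst_subst)
qed

text \<open>Freeness of variables is expressed through the substitutions that a formula cannot distinguish.\<close>

definition vars_below :: "nat \<Rightarrow> fm \<Rightarrow> bool" where
  "vars_below n A \<longleftrightarrow>
    (\<forall>\<sigma> \<sigma>' \<rho>. (\<forall>i<n. \<sigma> i = \<sigma>' i) \<longrightarrow> subst \<sigma> \<rho> A = subst \<sigma>' \<rho> A)"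

definition svars_below :: "nat \<Rightarrow> fm \<Rightarrow> bool" where
  "svars_below n A \<longleftrightarrow>
    (\<forall>\<sigma> \<rho> \<rho>'. (\<forall>i<n. \<rho> i = \<rho>' i) \<longrightarrow> subst \<sigma> \<rho> A = subst \<sigma> \<rho>' A)"

lemma tm_vars_below:
  "\<exists>n. \<forall>\<sigma> \<sigma>'. (\<forall>i<n. \<sigma> i = \<sigma>' i) \<longrightarrow> subst_tm \<sigma> t = subst_tm \<sigma>' t"
proof (induction t)
  case (Var i)
  then show ?case by (intro exI[of _ "Suc i"]) auto
next
  case (Add s t)
  then obtain m n where "\<forall>\<sigma> \<sigma>'. (\<forall>i<m. \<sigma> i = \<sigma>' i) \<longrightarrow> subst_tm \<sigma> s = subst_tm \<sigma>' s"
    "\<forall>\<sigma> \<sigma>'. (\<forall>i<n. \<sigma> i = \<sigma>' i) \<longrightarrow> subst_tm \<sigma> t = subst_tm \<sigma>' t" by blast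
  then show ?case by (intro exI[of _ "max m n"]) (simp add: less_max_iff_disj)
next
  case (Mul s t)
  then obtain m n where "\<forall>\<sigma> \<sigma>'. (\<forall>i<m. \<sigma> i = \<sigma>' i) \<longrightarrow> subst_tm \<sigma> s = subst_tm \<sigma>' s"
    "\<forall>\<sigma> \<sigma>'. (\<forall>i<n. \<sigma> i = \<sigma>' i) \<longrightarrow> subst_tm \<sigma> t = subst_tm \<sigma>' t" by blast
  then show ?case by (intro exI[of _ "max m n"]) (simp add: less_max_iff_disj)
qed auto

lemma vars_below_mono: "vars_below m A \<Longrightarrow> m \<le> n \<Longrightarrow> vars_below n A"
  unfolding vars_below_def by (meson order_less_le_trans)

lemma svars_below_mono: "svars_below m A \<Longrightarrow> m \<le> n \<Longrightarrow> svars_below n A"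
  unfolding svars_below_def by (meson order_less_le_trans)

lemma vars_below_AllN: "vars_below (Suc n) A \<Longrightarrow> vars_below n (AllN A)"
  unfolding vars_below_def subst.simps
proof (intro allI impI arg_cong[of _ _ AllN])
  fix \<sigma> \<sigma>' :: "nat \<Rightarrow> tm" and \<rho>
  assume A: "\<forall>\<sigma> \<sigma>' \<rho>. (\<forall>i<Suc n. \<sigma> i = \<sigma>' i) \<longrightarrow> subst \<sigma> \<rho> A = subst \<sigma>' \<rho> A"
    and "\<forall>i<n. \<sigma> i = \<sigma>' i"
  then have "\<forall>i<Suc n. case_nat (Var 0) (\<lambda>i. lift_tm (\<sigma> i)) i = case_nat (Var 0) (\<lambda>i. lift_tm (\<sigma>' i)) i"
    by (auto split: nat.split)
  with A show "subst (case_nat (Var 0) (\<lambda>i. lift_tm (\<sigma> i))) \<rho> A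
      = subst (case_nat (Var 0) (\<lambda>i. lift_tm (\<sigma>' i))) \<rho> A" by blast
qed

lemma svars_below_AllS: "svars_below (Suc n) A \<Longrightarrow> svars_below n (AllS A)"
  unfolding svars_below_def subst.simps
proof (intro allI impI arg_cong[of _ _ AllS])
  fix \<sigma> and \<rho> \<rho>' :: "nat \<Rightarrow> nat"
  assume A: "\<forall>\<sigma> \<rho> \<rho>'. (\<forall>i<Suc n. \<rho> i = \<rho>' i) \<longrightarrow> subst \<sigma> \<rho> A = subst \<sigma> \<rho>' A"
    and "\<forall>i<n. \<rho> i = \<rho>' i"
  then have "\<forall>i<Suc n. case_nat 0 (\<lambda>i. Suc (\<rho> i)) i = case_nat 0 (\<lambda>i. Suc (\<rho>' i)) i"
    by (auto split: nat.split)
  with A show "subst \<sigma> (case_nat 0 (\<lambda>i. Suc (\<rho> i))) A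
      = subst \<sigma> (case_nat 0 (\<lambda>i. Suc (\<rho>' i))) A" by blast
qed

lemma ex_vars_below: "\<exists>n. vars_below n A"
proof (induction A)
  case (Eq s t)
  obtain m n where "\<forall>\<sigma> \<sigma>'. (\<forall>i<m. \<sigma> i = \<sigma>' i) \<longrightarrow> subst_tm \<sigma> s = subst_tm \<sigma>' s"
    "\<forall>\<sigma> \<sigma>'. (\<forall>i<n. \<sigma> i = \<sigma>' i) \<longrightarrow> subst_tm \<sigma> t = subst_tm \<sigma>' t"
    using tm_vars_below by metis
  then show ?case unfolding vars_below_def by (intro exI[of _ "max m n"]) (simp add: less_max_iff_disj)
next
  case (Less s t)
  obtain m n where "\<forall>\<sigma> \<sigma>'. (\<forall>i<m. \<sigma> i = \<sigma>' i) \<longrightarrow> subst_tm \<sigma> s = subst_tm \<sigma>' s"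
    "\<forall>\<sigma> \<sigma>'. (\<forall>i<n. \<sigma> i = \<sigma>' i) \<longrightarrow> subst_tm \<sigma> t = subst_tm \<sigma>' t"
    using tm_vars_below by metis
  then show ?case unfolding vars_below_def by (intro exI[of _ "max m n"]) (simp add: less_max_iff_disj)
next
  case (Mem t X)
  then show ?case using tm_vars_below[of t] unfolding vars_below_def by simp
next
  case (Imp A B)
  then obtain m n where "vars_below m A" "vars_below n B" by blast
  then have "vars_below (max m n) A" "vars_below (max m n) B"
    by (auto intro: vars_below_mono)
  then have "vars_below (max m n) (Imp A B)"
    unfolding vars_below_def by (metis subst.simps(5))
  then show ?case ..
next
  case (AllN A)
  then obtain n where "vars_below n A" by blast
  then have "vars_below n (AllN A)" using vars_below_mono[of n A "Suc n"] vars_below_AllN by simp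
  then show ?case ..
next
  case (AllS A)
  then obtain n where "vars_below n A" by blast
  then have "vars_below n (AllS A)"
    unfolding vars_below_def by (metis subst.simps(7))
  then show ?case ..
qed (auto simp: vars_below_def)

lemma ex_svars_below: "\<exists>n. svars_below n A"
proof (induction A)
  case (Mem t X)
  then show ?case unfolding svars_below_def by (intro exI[of _ "Suc X"]) auto
next
  case (Imp A B)
  then obtain m n where "svars_below m A" "svars_below n B" by blast
  then have "svars_below (max m n) A" "svars_below (max m n) B"
    by (auto intro: svars_below_mono)
  then have "svars_below (max m n) (Imp A B)"
    unfolding svars_below_def by (metis subst.simps(5))
  then show ?case ..
next
  case (AllN A)
  then obtain n where "svars_below n A" by blast
  then have "svars_below n (AllN A)"
    unfolding svars_below_def by (metis subst.simps(6))
  then show ?case ..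
next
  case (AllS A)
  then obtain n where "svars_below n A" by blast
  then have "svars_below n (AllS A)" using svars_below_mono[of n A "Suc n"] svars_below_AllS by simp
  then show ?case ..
qed (auto simp: svars_below_def)

section \<open>Closure of provability under substitution\<close>

lemma deriv_weaken: "deriv T \<Gamma> A \<Longrightarrow> set \<Gamma> \<subseteq> set \<Delta> \<Longrightarrow> deriv T \<Delta> A"
proof (induction arbitrary: \<Delta> rule: deriv.induct)
  case (Ax A \<Gamma>)
  show ?case using Ax.hyps by (rule deriv.Ax)
next
  case (Hyp A \<Gamma>)
  then show ?case by (auto intro: deriv.Hyp)
next
  case (ImpI A \<Gamma> B)
  then show ?case by (metis deriv.ImpI list.simps(15) insert_mono)
next
  case (ImpE \<Gamma> A B)
  then show ?case by (meson deriv.ImpE)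
next
  case (Raa A \<Gamma>)
  then show ?case by (metis deriv.Raa list.simps(15) insert_mono)
next
  case (AllNI \<Gamma> A)
  then have "set (map liftN \<Gamma>) \<subseteq> set (map liftN \<Delta>)" by auto
  then show ?case by (intro deriv.AllNI AllNI.IH)
next
  case (AllNE \<Gamma> A t)
  then show ?case by (meson deriv.AllNE)
next
  case (AllSI \<Gamma> A)
  then have "set (map liftS \<Gamma>) \<subseteq> set (map liftS \<Delta>)" by auto
  then show ?case by (intro deriv.AllSI AllSI.IH)
next
  case (AllSE \<Gamma> A X)
  then show ?case by (meson deriv.AllSE)
next
  case (EqRefl \<Gamma> t)
  show ?case by (rule deriv.EqRefl)
next
  case (EqSubst \<Gamma> s t A)
  then show ?case by (meson deriv.EqSubst)
qed

text \<open>
  Generalizing all free variables and instantiating them again one by one avoids an induction on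
  derivations, which the axioms with free variables would obstruct.
\<close>

lemma proves_substN:
  assumes "vars_below n A" and "deriv T [] A" shows "deriv T [] (subst \<sigma> id A)"
  using assms
proof (induction n arbitrary: A \<sigma>)
  case 0
  then have "subst \<sigma> id A = subst Var id A" unfolding vars_below_def by blast
  then show ?case using 0(2) by (simp only: subst_Var)
next
  case (Suc n)
  have "deriv T [] (AllN A)" using Suc.prems by (auto intro: deriv.AllNI)
  then have "deriv T [] (subst (\<lambda>i. \<sigma> (Suc i)) id (AllN A))"
    by (rule Suc.IH[OF vars_below_AllN[OF Suc.prems(1)]])
  then have "deriv T [] (AllN (subst (case_nat (Var 0) (\<lambda>i. lift_tm (\<sigma> (Suc i)))) id A))"
    by simp
  from deriv.AllNE[OF this, of "\<sigma> 0"]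
  have "deriv T [] (subst (case_nat (\<sigma> 0) (\<lambda>i. \<sigma> (Suc i))) id A)"
    by (simp only: instN_subst)
  moreover have "case_nat (\<sigma> 0) (\<lambda>i. \<sigma> (Suc i)) = \<sigma>"
    by (auto simp: fun_eq_iff split: nat.split)
  ultimately show ?case by (simp only:)
qed

lemma proves_substS:
  assumes "svars_below n A" and "deriv T [] A" shows "deriv T [] (subst Var \<rho> A)"
  using assms
proof (induction n arbitrary: A \<rho>)
  case 0
  then have "subst Var \<rho> A = subst Var id A" unfolding svars_below_def by blast
  then show ?case using 0(2) by (simp only: subst_Var)
next
  case (Suc n)
  have "deriv T [] (AllS A)" using Suc.prems by (auto intro: deriv.AllSI)
  then have "deriv T [] (subst Var (\<lambda>i. \<rho> (Suc i)) (AllS A))"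
    by (rule Suc.IH[OF svars_below_AllS[OF Suc.prems(1)]])
  then have "deriv T [] (AllS (subst Var (case_nat 0 (\<lambda>i. Suc (\<rho> (Suc i)))) A))"
    by simp
  from deriv.AllSE[OF this, of "\<rho> 0"]
  have "deriv T [] (subst Var (case_nat (\<rho> 0) (\<lambda>i. \<rho> (Suc i))) A)"
    by (simp only: instS_subst)
  moreover have "case_nat (\<rho> 0) (\<lambda>i. \<rho> (Suc i)) = \<rho>"
    by (auto simp: fun_eq_iff split: nat.split)
  ultimately show ?case by (simp only:)
qed

lemma proves_subst:
  assumes "deriv T [] A" shows "deriv T [] (subst \<sigma> \<rho> A)"
proof -
  have "deriv T [] (subst \<sigma> id (subst Var \<rho> A))"
    using ex_vars_below ex_svars_below proves_substN proves_substS assms by metis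
  then show ?thesis by (simp add: subst_subst)
qed

text \<open>Discharging the context lets closure under substitution pass from theorems to
  derivations with hypotheses. \<open>foldl\<close> puts the head of the context innermost, in
  accordance with \<open>ImpI\<close>.\<close>

lemma deriv_Imps: "deriv T \<Gamma> A \<longleftrightarrow> deriv T [] (foldl (\<lambda>B C. Imp C B) A \<Gamma>)"
proof (induction \<Gamma> arbitrary: A)
  case (Cons C \<Gamma>)
  have "deriv T (C # \<Gamma>) A \<longleftrightarrow> deriv T \<Gamma> (Imp C A)"
  proof
    assume "deriv T \<Gamma> (Imp C A)"
    then have "deriv T (C # \<Gamma>) (Imp C A)" by (rule deriv_weaken) auto
    then show "deriv T (C # \<Gamma>) A" by (rule deriv.ImpE) (auto intro: deriv.Hyp)
  qed (rule deriv.ImpI)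
  then show ?case by (simp add: Cons)
qed simp

lemma deriv_subst:
  assumes "deriv T \<Gamma> A" shows "deriv T (map (subst \<sigma> \<rho>) \<Gamma>) (subst \<sigma> \<rho> A)"
proof -
  have "subst \<sigma> \<rho> (foldl (\<lambda>B C. Imp C B) A \<Gamma>)
      = foldl (\<lambda>B C. Imp C B) (subst \<sigma> \<rho> A) (map (subst \<sigma> \<rho>) \<Gamma>)"
    by (induction \<Gamma> arbitrary: A) auto
  then show ?thesis using assms proves_subst deriv_Imps by metis
qed

section \<open>Fresh variables and the Henkin theory\<close>

lemma ex_bound_list:
  fixes P :: "nat \<Rightarrow> 'a \<Rightarrow> bool"
  assumes "\<And>m n x. P m x \<Longrightarrow> m \<le> n \<Longrightarrow> P n x" and "\<And>x. \<exists>n. P n x"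
  shows "\<exists>n. \<forall>x\<in>set xs. P n x"
proof (induction xs)
  case (Cons x xs)
  then obtain m n where "\<forall>x\<in>set xs. P n x" "P m x" using assms(2) by blast
  then have "\<forall>y\<in>set (x # xs). P (max m n) y"
    using assms(1) by (metis max.cobounded1 max.cobounded2 set_ConsD)
  then show ?case ..
qed simp

text \<open>A variable k beyond those of \<open>B\<close> and \<Gamma> serves as the Henkin witness.
  The renaming \<sigma> sends k to the bound variable 0 and lifts the rest, which turns the instance
  into the premise of \<open>AllNI\<close>. Axioms of \<open>T\<close> may mention k, as
  \<open>deriv_subst\<close> respects their reading as universal closures.\<close>

lemma ex_fresh_AllN: "\<exists>k. deriv T \<Gamma> (instN (Var k) B) \<longrightarrow> deriv T \<Gamma> (AllN B)"
proof -
  obtain k where k: "\<forall>A\<in>set (B # \<Gamma>). vars_below k A"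
    using ex_bound_list[of vars_below] vars_below_mono ex_vars_below by metis
  have "deriv T \<Gamma> (AllN B)" if *: "deriv T \<Gamma> (instN (Var k) B)"
  proof -
    define \<sigma> where "\<sigma> = (\<lambda>i. if i = k then Var 0 else Var (Suc i))"
    have "map (subst \<sigma> id) \<Gamma> = map liftN \<Gamma>"
      using k by (auto simp: liftN_def vars_below_def \<sigma>_def)
    moreover have "subst \<sigma> id (instN (Var k) B) = subst Var id B"
    proof -
      have "vars_below k B" using k by simp
      moreover have "\<forall>i<k. subst_tm \<sigma> (case_nat (Var k) Var i) = Var i"
        by (auto simp: \<sigma>_def split: nat.split)
      ultimately show ?thesis
        unfolding instN_def subst_subst vars_below_def by (simp add: id_def)
    qed
    ultimately have "deriv T (map liftN \<Gamma>) B"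
      using deriv_subst[OF *, of \<sigma> id] by (simp only: subst_Var)
    then show ?thesis by (rule deriv.AllNI)
  qed
  then show ?thesis by blast
qed

lemma ex_fresh_AllS: "\<exists>k. deriv T \<Gamma> (instS k B) \<longrightarrow> deriv T \<Gamma> (AllS B)"
proof -
  obtain k where k: "\<forall>A\<in>set (B # \<Gamma>). svars_below k A"
    using ex_bound_list[of svars_below] svars_below_mono ex_svars_below by metis
  have "deriv T \<Gamma> (AllS B)" if *: "deriv T \<Gamma> (instS k B)"
  proof -
    define \<rho> where "\<rho> = (\<lambda>i. if i = k then 0 else Suc i)"
    have "map (subst Var \<rho>) \<Gamma> = map liftS \<Gamma>"
      using k by (auto simp: liftS_def svars_below_def \<rho>_def)
    moreover have "subst Var \<rho> (instS k B) = subst Var id B"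
    proof -
      have "svars_below k B" using k by simp
      moreover have "\<forall>i<k. \<rho> (case_nat k id i) = i"
        by (auto simp: \<rho>_def split: nat.split)
      ultimately show ?thesis
        unfolding instS_def subst_subst svars_below_def by (simp add: id_def)
    qed
    ultimately have "deriv T (map liftS \<Gamma>) B"
      using deriv_subst[OF *, of Var \<rho>] by (simp only: subst_Var)
    then show ?thesis by (rule deriv.AllSI)
  qed
  then show ?thesis by blast
qed

instance tm :: countable by countable_datatype
instance fm :: countable by countable_datatype

text \<open>A refuted universal formula has to bring a refuted instance with it, so that one pass
  through all formulas yields maximality and Henkin witnesses together.\<close>

definition decides :: "fm list \<Rightarrow> fm \<Rightarrow> bool" where
  "decides \<Gamma> A \<longleftrightarrow> A \<in> set \<Gamma> \<or> Neg A \<in> set \<Gamma> \<and>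
     (\<forall>B. A = AllN B \<longrightarrow> (\<exists>t. Neg (instN t B) \<in> set \<Gamma>)) \<and>
     (\<forall>B. A = AllS B \<longrightarrow> (\<exists>k. Neg (instS k B) \<in> set \<Gamma>))"

lemma henkin_step:
  assumes "\<not> deriv T \<Gamma> Bot"
  shows "\<exists>\<Delta>. \<not> deriv T \<Delta> Bot \<and> set \<Gamma> \<subseteq> set \<Delta> \<and> decides \<Delta> A"
proof (cases "deriv T (A # \<Gamma>) Bot")
  case False
  then show ?thesis by (intro exI[of _ "A # \<Gamma>"]) (auto simp: decides_def)
next
  case True
  have notA: "\<not> deriv T \<Gamma> A"
    using assms True deriv.ImpI deriv.ImpE by metis
  show ?thesis
  proof (cases "\<exists>B. A = AllN B \<or> A = AllS B")
    case False
    have "\<not> deriv T (Neg A # \<Gamma>) Bot" using notA deriv.Raa by metis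
    then show ?thesis using False
      by (intro exI[of _ "Neg A # \<Gamma>"]) (auto simp: decides_def)
  next
    case True
    \<comment> \<open>Contrapositive of the freshness lemmas: since \<open>A\<close> is underivable,
      so is one of its instances.\<close>
    then obtain B C where C: "\<not> deriv T \<Gamma> C" "A = AllN B \<and> (\<exists>t. C = instN t B) \<or> A = AllS B \<and> (\<exists>k. C = instS k B)"
      using notA ex_fresh_AllN ex_fresh_AllS by metis
    have CA: "deriv T (A # \<Delta>) C" for \<Delta>
      using C(2) by (metis deriv.Hyp deriv.AllNE deriv.AllSE list.set_intros(1))
    \<comment> \<open>\<open>A\<close> implies \<open>C\<close>, so \<open>Neg C\<close> already
      refutes \<open>A\<close>, and adding both negations is as consistent as adding
      \<open>Neg C\<close>.\<close>
    have "\<not> deriv T (Neg A # Neg C # \<Gamma>) Bot"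
    proof
      assume "deriv T (Neg A # Neg C # \<Gamma>) Bot"
      then have "deriv T (Neg C # \<Gamma>) A" by (rule deriv.Raa)
      moreover have "deriv T (Neg C # \<Gamma>) (Imp A C)" using CA by (rule deriv.ImpI)
      ultimately have "deriv T (Neg C # \<Gamma>) C" using deriv.ImpE by metis
      then have "deriv T (Neg C # \<Gamma>) Bot"
        by (metis deriv.ImpE deriv.Hyp list.set_intros(1))
      then show False using C(1) deriv.Raa by metis
    qed
    then show ?thesis using C(2)
      by (intro exI[of _ "Neg A # Neg C # \<Gamma>"]) (auto simp: decides_def)
  qed
qed

text \<open>\<open>M\<close> is the deductive closure of an increasing chain of finite contexts,
  whose n-th step decides the n-th formula. Each context is finite, so fresh variables never run out
  and the language stays unchanged.\<close>

lemma ex_henkin_theory: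
  assumes "\<not> deriv T [] A"
  obtains M where "M (Neg A)" and "\<And>B. deriv T [] B \<Longrightarrow> M B" and "\<not> M Bot"
    and "\<And>B C. M (Imp B C) \<longleftrightarrow> (M B \<longrightarrow> M C)"
    and "\<And>B. M (AllN B) \<longleftrightarrow> (\<forall>t. M (instN t B))"
    and "\<And>B. M (AllS B) \<longleftrightarrow> (\<forall>k. M (instS k B))"
    and "\<And>t. M (Eq t t)" and "\<And>s t B. M (Eq s t) \<Longrightarrow> M (instN s B) \<Longrightarrow> M (instN t B)"
proof -
  have "\<exists>G. \<forall>n. \<not> deriv T (G n) Bot \<and> (n = 0 \<longrightarrow> Neg A \<in> set (G n)) \<and>
      (set (G n) \<subseteq> set (G (Suc n)) \<and> decides (G (Suc n)) (from_nat n))"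
  proof -
    have "\<not> deriv T [Neg A] Bot" using assms deriv.Raa by blast
    then have "\<exists>G. \<forall>n. (\<not> deriv T (G n) Bot \<and> (n = 0 \<longrightarrow> Neg A \<in> set (G n))) \<and>
      (set (G n) \<subseteq> set (G (Suc n)) \<and> decides (G (Suc n)) (from_nat n))"
      by (intro dependent_nat_choice) (auto intro!: exI[of _ "[Neg A]"] henkin_step)
    then show ?thesis by simp
  qed
  then obtain G where G: "\<And>n. \<not> deriv T (G n) Bot" "Neg A \<in> set (G 0)"
    "\<And>n. set (G n) \<subseteq> set (G (Suc n))" "\<And>n. decides (G (Suc n)) (from_nat n)"
    by blast
  have mono: "m \<le> n \<Longrightarrow> set (G m) \<subseteq> set (G n)" for m n
    using lift_Suc_mono_le[of "\<lambda>n. set (G n)"] G(3) by blast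
  define M where "M B \<longleftrightarrow> (\<exists>n. deriv T (G n) B)" for B
  have MI: "B \<in> set (G n) \<Longrightarrow> M B" for B n
    unfolding M_def using deriv.Hyp by blast
  have M1: "M B \<Longrightarrow> (\<And>\<Gamma>. deriv T \<Gamma> B \<Longrightarrow> deriv T \<Gamma> C) \<Longrightarrow> M C" for B C
    unfolding M_def by blast
  \<comment> \<open>Two premises of a rule hold together at some stage of the chain, so
    \<open>M\<close> inherits the rule.\<close>
  have M2: "M B \<Longrightarrow> M C \<Longrightarrow> (\<And>\<Gamma>. deriv T \<Gamma> B \<Longrightarrow> deriv T \<Gamma> C \<Longrightarrow> deriv T \<Gamma> D) \<Longrightarrow> M D" for B C D
    unfolding M_def using mono deriv_weaken by (metis max.cobounded1 max.cobounded2)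
  have bot: "\<not> M Bot" using G(1) M_def by blast
  have dec: "\<exists>n. decides (G n) B" for B
    using G(4)[of "to_nat B"] by auto
  have neg: "M (Neg B) \<longleftrightarrow> \<not> M B" for B
  proof
    assume "M (Neg B)" then show "\<not> M B" using M2 bot deriv.ImpE by metis
  next
    assume "\<not> M B" then show "M (Neg B)" using dec[of B] MI unfolding decides_def by blast
  qed
  show thesis
  proof
    show "M (Neg A)" using G(2) MI by blast
    show "M B" if "deriv T [] B" for B
      unfolding M_def using deriv_weaken[OF that] by auto
    show "M (Imp B C) \<longleftrightarrow> (M B \<longrightarrow> M C)" for B C
    proof
      assume "M (Imp B C)" then show "M B \<longrightarrow> M C" using M2 deriv.ImpE by metis
    next
      assume *: "M B \<longrightarrow> M C"
      show "M (Imp B C)"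
      proof (cases "M C")
        case True
        then show ?thesis by (rule M1) (auto intro!: deriv.ImpI elim!: deriv_weaken)
      next
        case False
        then have "M (Neg B)" using * neg by blast
        then show ?thesis
        proof (rule M1)
          fix \<Gamma> assume "deriv T \<Gamma> (Neg B)"
          then have "deriv T (Neg C # B # \<Gamma>) (Neg B)" by (rule deriv_weaken) auto
          then have "deriv T (Neg C # B # \<Gamma>) Bot" by (rule deriv.ImpE) (auto intro: deriv.Hyp)
          then show "deriv T \<Gamma> (Imp B C)" using deriv.ImpI deriv.Raa by metis
        qed
      qed
    qed
    show "M (AllN B) \<longleftrightarrow> (\<forall>t. M (instN t B))" for B
      using dec[of "AllN B"] MI neg unfolding decides_def by (metis M1 deriv.AllNE fm.inject(5))
    show "M (AllS B) \<longleftrightarrow> (\<forall>k. M (instS k B))" for B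
      using dec[of "AllS B"] MI neg unfolding decides_def by (metis M1 deriv.AllSE fm.inject(6))
    show "M (Eq t t)" for t
      unfolding M_def by (blast intro: deriv.EqRefl)
    show "M (instN t B)" if "M (Eq s t)" "M (instN s B)" for s t B
      using that deriv.EqSubst by (rule M2)
  qed (rule bot)
qed

section \<open>Semantics and the term model\<close>

locale so_structure =
  fixes zero one :: 'a and add mul :: "'a \<Rightarrow> 'a \<Rightarrow> 'a" and less :: "'a \<Rightarrow> 'a \<Rightarrow> bool"
    and S :: "nat \<Rightarrow> 'a set"
begin

primrec ev :: "(nat \<Rightarrow> 'a) \<Rightarrow> tm \<Rightarrow> 'a" where
  "ev \<eta> (Var i) = \<eta> i"
| "ev \<eta> Zero = zero"
| "ev \<eta> One = one"
| "ev \<eta> (Add s t) = add (ev \<eta> s) (ev \<eta> t)"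
| "ev \<eta> (Mul s t) = mul (ev \<eta> s) (ev \<eta> t)"

text \<open>
  Set variables may be assigned arbitrary sets, but set quantifiers range over the sets \<open>S k\<close> only.
\<close>

primrec sat :: "(nat \<Rightarrow> 'a) \<Rightarrow> (nat \<Rightarrow> 'a set) \<Rightarrow> fm \<Rightarrow> bool" where
  "sat \<eta> r Bot \<longleftrightarrow> False"
| "sat \<eta> r (Eq s t) \<longleftrightarrow> ev \<eta> s = ev \<eta> t"
| "sat \<eta> r (Less s t) \<longleftrightarrow> less (ev \<eta> s) (ev \<eta> t)"
| "sat \<eta> r (Mem t X) \<longleftrightarrow> ev \<eta> t \<in> r X"
| "sat \<eta> r (Imp A B) \<longleftrightarrow> (sat \<eta> r A \<longrightarrow> sat \<eta> r B)"
| "sat \<eta> r (AllN A) \<longleftrightarrow> (\<forall>x. sat (case_nat x \<eta>) r A)"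
| "sat \<eta> r (AllS A) \<longleftrightarrow> (\<forall>k. sat \<eta> (case_nat (S k) r) A)"

lemma ev_subst_tm: "ev \<eta> (subst_tm \<sigma> t) = ev (\<lambda>i. ev \<eta> (\<sigma> i)) t"
  by (induction t) auto

lemma ev_lift_tm [simp]: "ev (case_nat x \<eta>) (lift_tm t) = ev \<eta> t"
  by (simp add: lift_tm_def ev_subst_tm)

lemma sat_subst: "sat \<eta> r (subst \<sigma> \<rho> A) \<longleftrightarrow> sat (\<lambda>i. ev \<eta> (\<sigma> i)) (\<lambda>i. r (\<rho> i)) A"
proof (induction A arbitrary: \<eta> r \<sigma> \<rho>)
  case (AllN A)
  have "(\<lambda>i. ev (case_nat x \<eta>) (case_nat (Var 0) (\<lambda>i. lift_tm (\<sigma> i)) i))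
      = case_nat x (\<lambda>i. ev \<eta> (\<sigma> i))" for x
    by (auto simp: fun_eq_iff split: nat.split)
  then show ?case by (simp add: AllN)
next
  case (AllS A)
  have "(\<lambda>i. case_nat Y r (case_nat 0 (\<lambda>i. Suc (\<rho> i)) i)) = case_nat Y (\<lambda>i. r (\<rho> i))" for Y
    by (auto simp: fun_eq_iff split: nat.split)
  then show ?case by (simp add: AllS)
qed (auto simp: ev_subst_tm)

end

text \<open>
  The basic axioms make successor injective but not surjective, so the term model is infinite and
  can be transported to the type of natural numbers.
\<close>

theorem completeness:
  assumes basic: "basic_axioms \<subseteq> T" and "\<not> T \<turnstile> A"
  obtains zero one :: nat and add mul less S where
    "\<And>B \<eta> \<rho>. B \<in> T \<Longrightarrow> so_structure.sat zero one add mul less S \<eta> (\<lambda>i. S (\<rho> i)) B"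
    "\<exists>\<eta> \<rho>. \<not> so_structure.sat zero one add mul less S \<eta> (\<lambda>i. S (\<rho> i)) A"
proof -
  have "\<not> deriv T [] A" using assms(2) by (simp add: proves_def)
  from ex_henkin_theory[OF this] obtain M where M: "M (Neg A)" "\<And>B. deriv T [] B \<Longrightarrow> M B" "\<not> M Bot"
    "\<And>B C. M (Imp B C) \<longleftrightarrow> (M B \<longrightarrow> M C)"
    "\<And>B. M (AllN B) \<longleftrightarrow> (\<forall>t. M (instN t B))"
    "\<And>B. M (AllS B) \<longleftrightarrow> (\<forall>k. M (instS k B))"
    "\<And>t. M (Eq t t)" "\<And>s t B. M (Eq s t) \<Longrightarrow> M (instN s B) \<Longrightarrow> M (instN t B)"
    by blast
  have cong: "M (subst (case_nat s Var) id B) \<Longrightarrow> M (subst (case_nat t Var) id B)" if "M (Eq s t)" for s t B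
    using M(8)[OF that] unfolding instN_def .
  have sym: "M (Eq t s)" if "M (Eq s t)" for s t
    using cong[OF that, of "Eq (Var 0) (lift_tm s)"] M(7) by simp
  have trans: "M (Eq s u)" if "M (Eq s t)" "M (Eq t u)" for s t u
    using cong[OF that(2), of "Eq (lift_tm s) (Var 0)"] that(1) by simp
  have cong_Add: "M (Eq (Add s u) (Add t v))" if "M (Eq s t)" "M (Eq u v)" for s t u v
  proof (rule trans)
    show "M (Eq (Add s u) (Add t u))"
      using cong[OF that(1), of "Eq (Add (lift_tm s) (lift_tm u)) (Add (Var 0) (lift_tm u))"] M(7) by simp
    show "M (Eq (Add t u) (Add t v))"
      using cong[OF that(2), of "Eq (Add (lift_tm t) (lift_tm u)) (Add (lift_tm t) (Var 0))"] M(7) by simp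
  qed
  have cong_Mul: "M (Eq (Mul s u) (Mul t v))" if "M (Eq s t)" "M (Eq u v)" for s t u v
  proof (rule trans)
    show "M (Eq (Mul s u) (Mul t u))"
      using cong[OF that(1), of "Eq (Mul (lift_tm s) (lift_tm u)) (Mul (Var 0) (lift_tm u))"] M(7) by simp
    show "M (Eq (Mul t u) (Mul t v))"
      using cong[OF that(2), of "Eq (Mul (lift_tm t) (lift_tm u)) (Mul (lift_tm t) (Var 0))"] M(7) by simp
  qed
  have cong_Less: "M (Less t v)" if "M (Eq s t)" "M (Eq u v)" "M (Less s u)" for s t u v
    using cong[OF that(1), of "Less (Var 0) (lift_tm u)"] cong[OF that(2), of "Less (lift_tm t) (Var 0)"]
      that(3) by simp
  have cong_Mem: "M (Mem t X)" if "M (Eq s t)" "M (Mem s X)" for s t X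
    using cong[OF that(1), of "Mem (Var 0) X"] that(2) by simp
  have axM: "M (subst \<sigma> \<rho> B)" if "B \<in> T" for \<sigma> \<rho> B
    using M(2) proves_subst deriv.Ax[OF that] by metis
  define cl where "cl t = {s. M (Eq t s)}" for t
  have cl: "cl s = cl t \<longleftrightarrow> M (Eq s t)" for s t
    unfolding cl_def using sym trans M(7) by blast
  have "infinite (range cl)"
  proof
    assume fin: "finite (range cl)"
    define f where "f c = cl (Add (SOME t. c = cl t) One)" for c
    have f: "f (cl t) = cl (Add t One)" for t
    proof -
      have "cl t = cl (SOME s. cl t = cl s)" by (rule someI[of _ t]) simp
      then show ?thesis unfolding f_def by (metis cl cong_Add M(7))
    qed
    have "inj_on f (range cl)"
    proof (rule inj_onI, clarsimp simp: f cl)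
      fix s t assume *: "M (Eq (Add s One) (Add t One))"
      have "Imp (Eq (Add (Var 0) One) (Add (Var 1) One)) (Eq (Var 0) (Var 1)) \<in> T"
        using basic by (simp add: basic_axioms_def Let_def)
      from axM[OF this, of "case_nat s (\<lambda>_. t)" id] show "M (Eq s t)" using * by (simp add: M(4))
    qed
    moreover have "f ` range cl \<subseteq> range cl" by (auto simp: f)
    ultimately have "f ` range cl = range cl" using endo_inj_surj fin by metis
    then obtain t where "cl Zero = cl (Add t One)" by (metis (no_types, lifting) f imageE rangeI)
    then have "M (Eq (Add t One) Zero)" by (simp add: cl[symmetric])
    moreover have "Neg (Eq (Add (Var 0) One) Zero) \<in> T"
      using basic by (simp add: basic_axioms_def Let_def)
    from axM[OF this, of "\<lambda>_. t" id] have "\<not> M (Eq (Add t One) Zero)" by (simp add: M(3,4))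
    ultimately show False by blast
  qed
  then have bij: "bij_betw (to_nat_on (range cl)) (range cl) UNIV"
    by (intro to_nat_on_infinite) auto
  define q where "q t = to_nat_on (range cl) (cl t)" for t
  have q: "q s = q t \<longleftrightarrow> M (Eq s t)" for s t
    unfolding q_def cl[symmetric] using bij by (auto simp: bij_betw_def inj_on_eq_iff)
  have "surj q"
    using bij unfolding bij_betw_def q_def by (metis image_image)
  define p where "p = inv q"
  have qp [simp]: "q (p a) = a" for a unfolding p_def using \<open>surj q\<close> by (simp add: surj_f_inv_f)
  have pq: "M (Eq (p (q t)) t)" for t using q by (metis qp)
  have pq': "M (Eq t (p (q t)))" for t using pq sym by blast
  define add where "add a b = q (Add (p a) (p b))" for a b
  define mul where "mul a b = q (Mul (p a) (p b))" for a b
  define less where "less a b \<longleftrightarrow> M (Less (p a) (p b))" for a b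
  define S where "S k = {a. M (Mem (p a) k)}" for k
  have add_q: "add (q s) (q t) = q (Add s t)" for s t
    unfolding add_def q by (rule cong_Add[OF pq pq])
  have mul_q: "mul (q s) (q t) = q (Mul s t)" for s t
    unfolding mul_def q by (rule cong_Mul[OF pq pq])
  have less_q: "less (q s) (q t) \<longleftrightarrow> M (Less s t)" for s t
    unfolding less_def using cong_Less pq pq' by blast
  have S_q: "q t \<in> S k \<longleftrightarrow> M (Mem t k)" for t k
    unfolding S_def using cong_Mem pq pq' by blast
  interpret so_structure "q Zero" "q One" add mul less S .
  have ev: "ev (\<lambda>i. q (\<sigma> i)) t = q (subst_tm \<sigma> t)" for \<sigma> t
    by (induction t) (auto simp: add_q mul_q)
  \<comment> \<open>Truth lemma. The simultaneous substitution keeps it inductive: a quantifier case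
    merely extends \<sigma> or \<rho>. Every number assignment has the form
    \<open>q (\<sigma> i)\<close> because \<open>q\<close> is onto.\<close>
  have truth: "sat (\<lambda>i. q (\<sigma> i)) (\<lambda>i. S (\<rho> i)) B \<longleftrightarrow> M (subst \<sigma> \<rho> B)" for \<sigma> \<rho> B
  proof (induction B arbitrary: \<sigma> \<rho>)
    case (AllN B)
    have "(\<forall>x. sat (case_nat x (\<lambda>i. q (\<sigma> i))) (\<lambda>i. S (\<rho> i)) B)
        \<longleftrightarrow> (\<forall>t. sat (\<lambda>i. q (case_nat t \<sigma> i)) (\<lambda>i. S (\<rho> i)) B)"
    proof -
      have "(\<lambda>i. q (case_nat t \<sigma> i)) = case_nat (q t) (\<lambda>i. q (\<sigma> i))" for t
        by (auto simp: fun_eq_iff split: nat.split)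
      then show ?thesis by (metis qp)
    qed
    then show ?case by (simp add: AllN M(5) instN_subst)
  next
    case (AllS B)
    have "(\<lambda>i. S (case_nat k \<rho> i)) = case_nat (S k) (\<lambda>i. S (\<rho> i))" for k
      by (auto simp: fun_eq_iff split: nat.split)
    then show ?case by (simp add: AllS[symmetric] M(6) instS_subst)
  qed (auto simp: ev q M(3,4) less_q S_q)
  show thesis
  proof
    show "sat \<eta> (\<lambda>i. S (\<rho> i)) B" if "B \<in> T" for \<eta> \<rho> B
      using truth[of "\<lambda>i. p (\<eta> i)" \<rho> B] axM[OF that] by simp
    have "\<not> sat (\<lambda>i. q (Var i)) (\<lambda>i. S (id i)) A"
      using truth[of Var id A] M(1,3,4) by simp
    then show "\<exists>\<eta> \<rho>. \<not> sat \<eta> (\<lambda>i. S (\<rho> i)) A" by blast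
  qed
qed


section \<open>Arithmetic in models of arithmetical comprehension\<close>

locale aca_model = so_structure zero one add mul less S
  for zero one :: 'a and add mul :: "'a \<Rightarrow> 'a \<Rightarrow> 'a" and less :: "'a \<Rightarrow> 'a \<Rightarrow> bool"
    and S :: "nat \<Rightarrow> 'a set" +
  fixes name :: "nat \<Rightarrow> 'a"
  assumes surj_name: "surj name"
    and sat_axioms: "\<And>B \<eta> \<rho>. B \<in> ACA0 \<Longrightarrow> sat \<eta> (\<lambda>i. S (\<rho> i)) B"
begin

notation zero ("\<zero>") and one ("\<one>") and add (infixl "\<oplus>" 65) and mul (infixl "\<otimes>" 70)
  and less (infix "\<prec>" 50)

text \<open>
  The even number variables are read off the environment and the odd ones name all elements of the
  model; all sets of the model are named as well.  So arithmetical definability below is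
  definability with arbitrary parameters.
\<close>

definition mix :: "(nat \<Rightarrow> 'a) \<Rightarrow> nat \<Rightarrow> 'a" where
  "mix e i = (if even i then e (i div 2) else name (i div 2))"

definition tdef :: "((nat \<Rightarrow> 'a) \<Rightarrow> 'a) \<Rightarrow> bool" where
  "tdef f \<longleftrightarrow> (\<exists>t. \<forall>e. f e = ev (mix e) t)"

definition adef :: "((nat \<Rightarrow> 'a) \<Rightarrow> bool) \<Rightarrow> bool" where
  "adef P \<longleftrightarrow> (\<exists>A. arithmetical A \<and> (\<forall>e. P e \<longleftrightarrow> sat (mix e) S A))"

lemma tdef_var: "tdef (\<lambda>e. e k)"
  unfolding tdef_def by (intro exI[of _ "Var (2 * k)"]) (simp add: mix_def)

lemma tdef_const: "tdef (\<lambda>e. a)"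
proof -
  obtain k where "name k = a" using surj_name by (metis surjD)
  then show ?thesis
    unfolding tdef_def by (intro exI[of _ "Var (Suc (2 * k))"]) (simp add: mix_def)
qed

lemma tdef_add: "tdef f \<Longrightarrow> tdef g \<Longrightarrow> tdef (\<lambda>e. f e \<oplus> g e)"
  unfolding tdef_def by (metis ev.simps(4))

lemma tdef_mul: "tdef f \<Longrightarrow> tdef g \<Longrightarrow> tdef (\<lambda>e. f e \<otimes> g e)"
  unfolding tdef_def by (metis ev.simps(5))

lemma tdef_ev: "(\<And>i. tdef (\<lambda>e. \<eta> e i)) \<Longrightarrow> tdef (\<lambda>e. ev (\<eta> e) t)"
  by (induction t) (auto intro: tdef_const tdef_add tdef_mul)

lemma adef_const: "adef (\<lambda>e. b)"
  unfolding adef_def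
  by (cases b) (auto intro: exI[of _ Bot] exI[of _ "Imp Bot Bot"])

lemma adef_eq: "tdef f \<Longrightarrow> tdef g \<Longrightarrow> adef (\<lambda>e. f e = g e)"
  unfolding adef_def tdef_def by (metis arithmetical.simps(2) sat.simps(2))

lemma adef_less: "tdef f \<Longrightarrow> tdef g \<Longrightarrow> adef (\<lambda>e. f e \<prec> g e)"
  unfolding adef_def tdef_def by (metis arithmetical.simps(3) sat.simps(3))

lemma adef_mem: "U \<in> range S \<Longrightarrow> tdef f \<Longrightarrow> adef (\<lambda>e. f e \<in> U)"
  unfolding adef_def tdef_def by (metis arithmetical.simps(4) rangeE sat.simps(4))

lemma adef_imp: "adef P \<Longrightarrow> adef Q \<Longrightarrow> adef (\<lambda>e. P e \<longrightarrow> Q e)"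
  unfolding adef_def by (metis arithmetical.simps(5) sat.simps(5))

lemma adef_not: "adef P \<Longrightarrow> adef (\<lambda>e. \<not> P e)"
  using adef_imp[OF _ adef_const[of False]] by simp

lemma adef_or: "adef P \<Longrightarrow> adef Q \<Longrightarrow> adef (\<lambda>e. P e \<or> Q e)"
  using adef_imp[OF adef_not] by (simp add: imp_conv_disj)

lemma adef_and: "adef P \<Longrightarrow> adef Q \<Longrightarrow> adef (\<lambda>e. P e \<and> Q e)"
  using adef_not[OF adef_or[OF adef_not adef_not]] by simp

lemma adef_iff: "adef P \<Longrightarrow> adef Q \<Longrightarrow> adef (\<lambda>e. P e \<longleftrightarrow> Q e)"
  unfolding iff_conv_conj_imp by (intro adef_and adef_imp)

text \<open>A quantifier puts its value in front of the interleaved assignment and moves every other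
  variable up by one. The renaming makes that value the first entry of the environment, lets the old
  entries follow it, and keeps the names at the odd places.\<close>

definition shift :: "nat \<Rightarrow> tm" where
  "shift i = (if i = 0 then Var 0 else if even i then Var (i - 1) else Var (Suc i))"

lemma arithmetical_subst [simp]: "arithmetical (subst \<sigma> \<rho> A) = arithmetical A"
  by (induction A arbitrary: \<sigma> \<rho>) auto

lemma sat_shift: "sat (case_nat x (mix e)) r (subst shift id A) \<longleftrightarrow> sat (mix (case_nat x e)) r A"
proof -
  have "ev (case_nat x (mix e)) (shift i) = mix (case_nat x e) i" for i
  proof (cases "even i")
    case True
    then obtain k where "i = 2 * k" by blast
    then show ?thesis by (cases k) (auto simp: shift_def mix_def)
  next
    case False
    then obtain k where "i = 2 * k + 1" by (blast elim: oddE)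
    then show ?thesis by (auto simp: shift_def mix_def)
  qed
  then show ?thesis by (simp add: sat_subst)
qed

lemma adef_all:
  assumes "adef (\<lambda>e. Q (\<lambda>i. e (Suc i)) (e 0))"
  shows "adef (\<lambda>e. \<forall>x. Q e x)"
proof -
  obtain A where A: "arithmetical A" "\<And>e. Q (\<lambda>i. e (Suc i)) (e 0) \<longleftrightarrow> sat (mix e) S A"
    using assms unfolding adef_def by blast
  have "(\<forall>x. Q e x) \<longleftrightarrow> sat (mix e) S (AllN (subst shift id A))" for e
    using A(2)[of "case_nat _ e"] by (simp add: sat_shift)
  then show ?thesis using A(1) unfolding adef_def
    by (intro exI[of _ "AllN (subst shift id A)"]) simp
qed

lemma adef_ex:
  assumes "adef (\<lambda>e. Q (\<lambda>i. e (Suc i)) (e 0))"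
  shows "adef (\<lambda>e. \<exists>x. Q e x)"
  using adef_not[OF adef_all[OF adef_not[OF assms]]] by simp

lemma adef_subst:
  assumes "adef P" and "\<And>i. tdef (\<lambda>e. g e i)"
  shows "adef (\<lambda>e. P (g e))"
proof -
  obtain A where A: "arithmetical A" "\<And>e. P e \<longleftrightarrow> sat (mix e) S A"
    using assms(1) unfolding adef_def by blast
  obtain T where T: "\<And>i e. g e i = ev (mix e) (T i)"
    using assms(2) unfolding tdef_def by metis
  define \<sigma> where "\<sigma> i = (if even i then T (i div 2) else Var i)" for i
  have "ev (mix e) (\<sigma> i) = mix (g e) i" for e i
    by (auto simp: \<sigma>_def T mix_def)
  then have "P (g e) \<longleftrightarrow> sat (mix e) S (subst \<sigma> id A)" for e
    by (simp add: sat_subst A(2))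
  then show ?thesis using A(1) unfolding adef_def by (metis arithmetical_subst)
qed

lemma tdef_lift: "tdef f \<Longrightarrow> tdef (\<lambda>e. f (\<lambda>i. e (Suc i)))"
proof -
  assume "tdef f"
  then obtain t where t: "\<And>e. f e = ev (mix e) t" unfolding tdef_def by blast
  have "tdef (\<lambda>e. mix (\<lambda>i. e (Suc i)) i)" for i
    by (cases "even i") (auto simp: mix_def intro: tdef_var tdef_const)
  then show ?thesis unfolding t by (rule tdef_ev)
qed

lemma tdef_case: "tdef f \<Longrightarrow> (\<And>i. tdef (\<lambda>e. g e i)) \<Longrightarrow> tdef (\<lambda>e. case_nat (f e) (g e) i)"
  by (cases i) auto

text \<open>With the next two lemmas, a predicate shown definable once can be reused at any
  definable arguments, in particular beneath further quantifiers.\<close>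

lemma adef_1: "adef (\<lambda>e. R (e 0)) \<Longrightarrow> tdef f \<Longrightarrow> adef (\<lambda>e. R (f e))"
  using adef_subst[of "\<lambda>e. R (e 0)" "\<lambda>e _. f e"] by simp

lemma adef_2: "adef (\<lambda>e. R (e 0) (e 1)) \<Longrightarrow> tdef f \<Longrightarrow> tdef g \<Longrightarrow> adef (\<lambda>e. R (f e) (g e))"
  using adef_subst[of "\<lambda>e. R (e 0) (e 1)" "\<lambda>e. case_nat (f e) (\<lambda>_. g e)"]
  by (simp add: tdef_case)

lemma adef_3: "adef (\<lambda>e. R (e 0) (e 1) (e 2)) \<Longrightarrow> tdef f \<Longrightarrow> tdef g \<Longrightarrow> tdef h
    \<Longrightarrow> adef (\<lambda>e. R (f e) (g e) (h e))"
  using adef_subst[of "\<lambda>e. R (e 0) (e 1) (e 2)" "\<lambda>e. case_nat (f e) (case_nat (g e) (\<lambda>_. h e))"]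
  by (simp add: tdef_case numeral_2_eq_2)

lemmas adef_intros = adef_const adef_eq adef_less adef_imp adef_not adef_or adef_and adef_iff
  adef_all adef_ex tdef_var tdef_const tdef_add tdef_mul

text \<open>The sets assigned to set variables may vary with the environment: each membership atom
  is replaced by its definition. In this way \<phi> and \<psi> are later evaluated at sections of
  coded sets, with the code itself quantified.\<close>

lemma adef_sat:
  assumes "arithmetical A" and "\<And>i. tdef (\<lambda>e. \<eta> e i)"
    and "\<And>i. adef (\<lambda>e. e 0 \<in> R (\<lambda>k. e (Suc k)) i)"
  shows "adef (\<lambda>e. sat (\<eta> e) (R e) A)"
  using assms
proof (induction A arbitrary: \<eta> R)
  case (Mem t X)
  have "adef (\<lambda>e. (case_nat (ev (\<eta> e) t) e) 0 \<in> R (\<lambda>k. (case_nat (ev (\<eta> e) t) e) (Suc k)) X)"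
    by (rule adef_subst[OF Mem.prems(3)]) (intro tdef_case tdef_ev Mem.prems(2) tdef_var)
  then show ?case by simp
next
  case (AllN A)
  have "adef (\<lambda>e. sat (case_nat (e 0) (\<eta> (\<lambda>i. e (Suc i)))) (R (\<lambda>i. e (Suc i))) A)"
  proof (rule AllN.IH)
    show "tdef (\<lambda>e. case_nat (e 0) (\<eta> (\<lambda>i. e (Suc i))) i)" for i
      by (intro tdef_case tdef_var tdef_lift AllN.prems(2))
    have "adef (\<lambda>e. (case_nat (e 0) (\<lambda>k. e (Suc (Suc k)))) 0
        \<in> R (\<lambda>k. (case_nat (e 0) (\<lambda>k. e (Suc (Suc k)))) (Suc k)) i)" for i
      by (rule adef_subst[OF AllN.prems(3)]) (intro tdef_case tdef_var)
    then show "adef (\<lambda>e. e 0 \<in> R (\<lambda>k. e (Suc (Suc k))) i)" for i by simp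
  qed (use AllN.prems in simp)
  then have "adef (\<lambda>e. \<forall>x. sat (case_nat x (\<eta> e)) (R e) A)"
    by (intro adef_all)
  then show ?case by simp
qed (auto intro!: adef_intros tdef_ev)

section \<open>Comprehension and induction for definable predicates\<close>

lemma comprehension:
  assumes "adef (\<lambda>e. P (e 0))" shows "{x. P x} \<in> range S"
proof -
  obtain A where A: "arithmetical A" "\<And>e. P (e 0) \<longleftrightarrow> sat (mix e) S A"
    using assms unfolding adef_def by blast
  define e where "e = (\<lambda>_::nat. zero)"
  have "sat (mix e) (\<lambda>i. S (id i)) (comprehension (subst shift id A))"
    using A(1) by (intro sat_axioms) (auto simp: ACA0_def)
  then obtain k where "\<And>x. x \<in> S k \<longleftrightarrow> sat (case_nat x (mix e)) S (subst shift id A)"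
    by (auto simp: comprehension_def liftS_def sat_subst)
  then have "x \<in> S k \<longleftrightarrow> P x" for x
    using A(2)[of "case_nat x e"] by (simp add: sat_shift)
  then have "{x. P x} = S k" by auto
  then show ?thesis by simp
qed

text \<open>The induction axiom speaks of sets; comprehension turns a definable predicate into
  one.\<close>

lemma number_induct [case_names definable zero Suc]:
  assumes "adef (\<lambda>e. P (e 0))" and "P \<zero>" and "\<And>x. P x \<Longrightarrow> P (x \<oplus> \<one>)"
  shows "P x"
proof -
  obtain k where k: "{x. P x} = S k" using comprehension[OF assms(1)] by blast
  have "sat undefined (\<lambda>i. S ((\<lambda>_. k) i)) induction_axiom"
    by (rule sat_axioms) (simp add: ACA0_def)
  then show ?thesis using assms(2,3) by (simp add: induction_axiom_def k[symmetric])
qed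

section \<open>Elementary arithmetic\<close>

lemma sat_basic: "B \<in> basic_axioms \<Longrightarrow> sat (case_nat a (\<lambda>_. b)) S B"
  using sat_axioms[of B _ "\<lambda>i. i"] by (simp add: ACA0_def)

lemma
  shows Suc_neq_zero: "a \<oplus> \<one> \<noteq> \<zero>"
    and Suc_inject: "a \<oplus> \<one> = b \<oplus> \<one> \<Longrightarrow> a = b"
    and add_zero: "a \<oplus> \<zero> = a"
    and add_Suc: "a \<oplus> (b \<oplus> \<one>) = (a \<oplus> b) \<oplus> \<one>"
    and mul_zero: "a \<otimes> \<zero> = \<zero>"
    and mul_Suc: "a \<otimes> (b \<oplus> \<one>) = (a \<otimes> b) \<oplus> a"
    and not_less_zero: "\<not> a \<prec> \<zero>"
    and less_Suc: "a \<prec> b \<oplus> \<one> \<longleftrightarrow> a \<prec> b \<or> a = b"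
  using sat_basic[of "Neg (Eq (Add (Var 0) One) Zero)" a]
    sat_basic[of "Imp (Eq (Add (Var 0) One) (Add (Var 1) One)) (Eq (Var 0) (Var 1))" a b]
    sat_basic[of "Eq (Add (Var 0) Zero) (Var 0)" a]
    sat_basic[of "Eq (Add (Var 0) (Add (Var 1) One)) (Add (Add (Var 0) (Var 1)) One)" a b]
    sat_basic[of "Eq (Mul (Var 0) Zero) Zero" a]
    sat_basic[of "Eq (Mul (Var 0) (Add (Var 1) One)) (Add (Mul (Var 0) (Var 1)) (Var 0))" a b]
    sat_basic[of "Neg (Less (Var 0) Zero)" a]
    sat_basic[of "Iff (Less (Var 0) (Add (Var 1) One)) (Or (Less (Var 0) (Var 1)) (Eq (Var 0) (Var 1)))" a b]
  by (auto simp: basic_axioms_def Let_def)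

lemma zero_add: "\<zero> \<oplus> a = a"
  by (induction a rule: number_induct, intro adef_intros) (simp_all add: add_zero add_Suc)

lemma Suc_add: "(a \<oplus> \<one>) \<oplus> b = (a \<oplus> b) \<oplus> \<one>"
  by (induction b rule: number_induct, intro adef_intros) (simp_all add: add_zero add_Suc)

lemma add_commute: "a \<oplus> b = b \<oplus> a"
  by (induction b rule: number_induct, intro adef_intros) (simp_all add: add_zero zero_add add_Suc Suc_add)

lemma add_assoc: "(a \<oplus> b) \<oplus> c = a \<oplus> (b \<oplus> c)"
  by (induction c rule: number_induct, intro adef_intros) (simp_all add: add_zero add_Suc)

lemma add_left_commute: "a \<oplus> (b \<oplus> c) = b \<oplus> (a \<oplus> c)"
  by (metis add_assoc add_commute)

lemma zero_mul: "\<zero> \<otimes> a = \<zero>"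
  by (induction a rule: number_induct, intro adef_intros) (simp_all add: add_zero mul_zero mul_Suc)

lemma Suc_mul: "(a \<oplus> \<one>) \<otimes> b = a \<otimes> b \<oplus> b"
proof (induction b rule: number_induct, intro adef_intros)
  show "(a \<oplus> \<one>) \<otimes> \<zero> = a \<otimes> \<zero> \<oplus> \<zero>" by (simp add: mul_zero add_zero)
  show "(a \<oplus> \<one>) \<otimes> (x \<oplus> \<one>) = a \<otimes> (x \<oplus> \<one>) \<oplus> (x \<oplus> \<one>)" if "(a \<oplus> \<one>) \<otimes> x = a \<otimes> x \<oplus> x" for x
    unfolding mul_Suc that by (metis add_assoc add_commute)
qed

lemma mul_commute: "a \<otimes> b = b \<otimes> a"
  by (induction b rule: number_induct, intro adef_intros) (simp_all add: mul_zero zero_mul mul_Suc Suc_mul)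

lemma distrib: "a \<otimes> (b \<oplus> c) = a \<otimes> b \<oplus> a \<otimes> c"
proof (induction c rule: number_induct, intro adef_intros)
  case (Suc c)
  then show ?case by (simp only: add_Suc mul_Suc) (simp only: add_assoc)
qed (simp_all add: add_zero mul_zero)

lemma mul_assoc: "(a \<otimes> b) \<otimes> c = a \<otimes> (b \<otimes> c)"
proof (induction c rule: number_induct, intro adef_intros)
  case (Suc c)
  then show ?case by (simp only: mul_Suc) (simp only: distrib)
qed (simp_all add: mul_zero)

lemma mul_one: "a \<otimes> \<one> = a"
  by (metis zero_add mul_Suc mul_zero)

lemma one_mul: "\<one> \<otimes> a = a"
  by (metis mul_one mul_commute)

lemma distrib_right: "(a \<oplus> b) \<otimes> c = a \<otimes> c \<oplus> b \<otimes> c"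
  by (metis distrib mul_commute)

lemma mul_left_commute: "a \<otimes> (b \<otimes> c) = b \<otimes> (a \<otimes> c)"
  by (metis mul_assoc mul_commute)

lemmas semiring = add_zero zero_add mul_zero zero_mul mul_one one_mul distrib distrib_right
  add_assoc add_commute add_left_commute mul_assoc mul_commute mul_left_commute

lemma add_cancel: "a \<oplus> c = b \<oplus> c \<longleftrightarrow> a = b"
proof -
  have "a \<oplus> c = b \<oplus> c \<longrightarrow> a = b"
    by (induction c rule: number_induct, intro adef_intros) (auto simp: add_zero add_Suc dest: Suc_inject)
  then show ?thesis by blast
qed

lemma add_left_cancel: "c \<oplus> a = c \<oplus> b \<longleftrightarrow> a = b"
  by (metis add_cancel add_commute)

lemma zero_or_Suc: "a = \<zero> \<or> (\<exists>b. a = b \<oplus> \<one>)"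
  by (induction a rule: number_induct, intro adef_intros) auto

lemma add_eq_zero: "a \<oplus> b = \<zero> \<Longrightarrow> b = \<zero>"
  by (metis zero_or_Suc add_Suc Suc_neq_zero)

lemma add_Suc_neq: "a \<oplus> (d \<oplus> \<one>) \<noteq> a"
  by (metis add_left_cancel add_zero Suc_neq_zero)

text \<open>The axioms give \<open>less\<close> by recursion on its right argument. Expressed
  through addition, order reasoning becomes algebra; \<open>d \<oplus> \<one>\<close> is the
  positive difference.\<close>

lemma less_iff: "a \<prec> b \<longleftrightarrow> (\<exists>d. b = a \<oplus> (d \<oplus> \<one>))"
proof (induction b rule: number_induct, intro adef_intros)
  show "a \<prec> \<zero> \<longleftrightarrow> (\<exists>d. \<zero> = a \<oplus> (d \<oplus> \<one>))"
    by (metis not_less_zero add_Suc Suc_neq_zero)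
  show "a \<prec> x \<oplus> \<one> \<longleftrightarrow> (\<exists>d. x \<oplus> \<one> = a \<oplus> (d \<oplus> \<one>))" if "a \<prec> x \<longleftrightarrow> (\<exists>d. x = a \<oplus> (d \<oplus> \<one>))" for x
  proof -
    have "(\<exists>d. x \<oplus> \<one> = a \<oplus> (d \<oplus> \<one>)) \<longleftrightarrow> (\<exists>d. x = a \<oplus> d)"
      by (metis add_Suc add_cancel)
    also have "\<dots> \<longleftrightarrow> (\<exists>d. x = a \<oplus> (d \<oplus> \<one>)) \<or> a = x"
      by (metis zero_or_Suc add_zero)
    finally show ?thesis using that less_Suc by metis
  qed
qed

lemma linear: "a \<prec> b \<or> a = b \<or> b \<prec> a"
proof (induction a rule: number_induct, intro adef_intros)
  show "\<zero> \<prec> b \<or> \<zero> = b \<or> b \<prec> \<zero>" by (metis less_iff zero_add zero_or_Suc)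
  show "x \<oplus> \<one> \<prec> b \<or> x \<oplus> \<one> = b \<or> b \<prec> x \<oplus> \<one>" if "x \<prec> b \<or> x = b \<or> b \<prec> x" for x
    using that
  proof (elim disjE)
    assume "x \<prec> b"
    then obtain d where "b = x \<oplus> (d \<oplus> \<one>)" using less_iff by blast
    then have "b = x \<oplus> \<one> \<oplus> d" by (metis add_assoc add_commute)
    then show ?thesis by (metis less_iff zero_or_Suc add_zero)
  qed (auto simp: less_Suc)
qed

text \<open>Phrased through addition so that monotonicity of terms follows from the semiring
  laws.\<close>

definition leq :: "'a \<Rightarrow> 'a \<Rightarrow> bool" (infix "\<preceq>" 50) where
  "a \<preceq> b \<longleftrightarrow> (\<exists>d. b = a \<oplus> d)"

lemma leq_refl: "a \<preceq> a"
  unfolding leq_def by (metis add_zero)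

lemma less_leq_trans: "a \<prec> b \<Longrightarrow> b \<preceq> c \<Longrightarrow> a \<prec> c"
  unfolding less_iff leq_def by (metis add_assoc add_commute)

lemma less_imp_leq: "a \<prec> b \<Longrightarrow> a \<preceq> b"
  unfolding less_iff leq_def by blast

lemma less_trans: "a \<prec> b \<Longrightarrow> b \<prec> c \<Longrightarrow> a \<prec> c"
  using less_leq_trans less_imp_leq by blast

lemma leq_add: "a \<preceq> a \<oplus> b" "a \<preceq> b \<oplus> a"
  unfolding leq_def by (auto intro: add_commute)

lemma add_mono: "a \<preceq> c \<Longrightarrow> b \<preceq> d \<Longrightarrow> a \<oplus> b \<preceq> c \<oplus> d"
  unfolding leq_def by (metis add_assoc add_commute)

lemma mul_mono: "a \<preceq> c \<Longrightarrow> b \<preceq> d \<Longrightarrow> a \<otimes> b \<preceq> c \<otimes> d"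
  unfolding leq_def by (metis add_assoc distrib distrib_right)

lemma ev_mono: "(\<And>i. \<eta> i \<preceq> \<eta>' i) \<Longrightarrow> ev \<eta> t \<preceq> ev \<eta>' t"
  by (induction t) (auto intro: leq_refl add_mono mul_mono)

lemma less_induct:
  assumes "adef (\<lambda>e. P (e 0))" and "\<And>x. (\<And>y. y \<prec> x \<Longrightarrow> P y) \<Longrightarrow> P x"
  shows "P x"
proof -
  have "\<forall>y. y \<prec> x \<longrightarrow> P y" for x
    by (induction x rule: number_induct, intro adef_intros adef_1[OF assms(1)])
      (auto simp: not_less_zero less_Suc intro: assms(2))
  then show ?thesis using assms(2) by blast
qed

section \<open>Pairing\<close>

definition pr :: "'a \<Rightarrow> 'a \<Rightarrow> 'a" where
  "pr a b = (a \<oplus> b) \<otimes> (a \<oplus> b) \<oplus> a"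

lemma tdef_pr: "tdef f \<Longrightarrow> tdef g \<Longrightarrow> tdef (\<lambda>e. pr (f e) (g e))"
  unfolding pr_def by (intro adef_intros)

text \<open>With s = i + j, the next square (s + 1)^2 already exceeds s^2 + i, so pairs with
  different sums have separated codes.\<close>

lemma pr_neq:
  assumes "i \<oplus> j \<prec> i' \<oplus> j'" shows "pr i j \<noteq> pr i' j'"
proof
  assume eq: "pr i j = pr i' j'"
  obtain d where d: "i' \<oplus> j' = (i \<oplus> j) \<oplus> (d \<oplus> \<one>)" using assms less_iff by blast
  let ?s = "i \<oplus> j"
  have "?s \<otimes> ?s \<oplus> i = (?s \<oplus> (d \<oplus> \<one>)) \<otimes> (?s \<oplus> (d \<oplus> \<one>)) \<oplus> i'"
    using eq unfolding pr_def d .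
  \<comment> \<open>After cancelling the square, the right side is i plus a successor. The summands
    j, i, j and the outer i make up the double of i + j.\<close>
  also have "\<dots> = ?s \<otimes> ?s \<oplus> (i \<oplus> ((j \<oplus> i \<oplus> j \<oplus> (?s \<oplus> ?s) \<otimes> d \<oplus> d \<otimes> d \<oplus> d \<oplus> d \<oplus> i') \<oplus> \<one>))"
    by (simp add: semiring)
  finally show False using add_left_cancel add_Suc_neq by metis
qed

lemma pr_inject [simp]: "pr i j = pr i' j' \<longleftrightarrow> i = i' \<and> j = j'"
proof
  assume eq: "pr i j = pr i' j'"
  then have "i \<oplus> j = i' \<oplus> j'" using pr_neq linear by metis
  with eq show "i = i' \<and> j = j'" unfolding pr_def by (metis add_left_cancel)
qed simp

section \<open>Divisibility, and coding of bounded sets by Goedel's beta function\<close>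

definition dv :: "'a \<Rightarrow> 'a \<Rightarrow> bool" where
  "dv a b \<longleftrightarrow> (\<exists>c. b = a \<otimes> c)"

lemma dv_mul: "dv a b \<Longrightarrow> dv a (b \<otimes> c)" "dv a b \<Longrightarrow> dv a (c \<otimes> b)"
  unfolding dv_def by (metis mul_assoc mul_commute)+

lemma dv_refl: "dv a a"
  unfolding dv_def by (metis mul_one)

text \<open>In place of a subtraction the two quotients are compared. If r = s + t, then p t + c =
  0, which forces c to be 0.\<close>

lemma dv_add_right:
  assumes "dv p a" and "dv p (a \<oplus> c)" shows "dv p c"
proof -
  obtain r s where rs: "a = p \<otimes> r" "a \<oplus> c = p \<otimes> s" using assms dv_def by metis
  consider t where "s = r \<oplus> t" | t where "r = s \<oplus> t"
    using linear[of r s] less_iff add_zero by metis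
  then show ?thesis
  proof cases
    case 1
    then have "c = p \<otimes> t" using rs by (metis distrib add_left_cancel)
    then show ?thesis unfolding dv_def by blast
  next
    case 2
    then have "p \<otimes> s \<oplus> (p \<otimes> t \<oplus> c) = p \<otimes> s \<oplus> \<zero>" using rs by (metis distrib add_assoc add_zero)
    then have "c = \<zero>" using add_left_cancel add_eq_zero by blast
    then show ?thesis unfolding dv_def by (metis mul_zero)
  qed
qed

text \<open>The moduli of Goedel's beta function.\<close>

definition modulus :: "'a \<Rightarrow> 'a \<Rightarrow> 'a" where
  "modulus v x = (x \<oplus> \<one>) \<otimes> v \<oplus> \<one>"

text \<open>
  Modulo \<open>p = (x + 1) v + 1\<close> the number \<open>(x + 1) v\<close> is \<open>- 1\<close>, so every divisor of a power of
  \<open>v\<close> can be cancelled.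
\<close>

lemma modulus_cancel:
  assumes "v = k \<otimes> w" and "dv (modulus v x) (u \<otimes> (k \<otimes> v))"
  shows "dv (modulus v x) u"
proof -
  define p where "p = modulus v x"
  define y where "y = (x \<oplus> \<one>) \<otimes> v"
  have p: "p = y \<oplus> \<one>" unfolding p_def modulus_def y_def ..
  have "u \<otimes> (y \<otimes> y) = (u \<otimes> (k \<otimes> v)) \<otimes> (w \<otimes> ((x \<oplus> \<one>) \<otimes> (x \<oplus> \<one>)))"
    unfolding y_def by (subst (2) assms(1)) (simp only: mul_assoc mul_commute mul_left_commute)
  then have "dv p (u \<otimes> (y \<otimes> y))" using dv_mul(1)[OF assms(2)] by (simp add: p_def)
  moreover have "u \<otimes> (y \<otimes> y) \<oplus> u \<otimes> y = p \<otimes> (u \<otimes> y)"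
    by (simp add: p semiring)
  ultimately have "dv p (u \<otimes> y)" using dv_add_right dv_mul(1) dv_refl by metis
  moreover have "u \<otimes> y \<oplus> u = p \<otimes> u" by (simp add: p semiring)
  ultimately show ?thesis using dv_add_right dv_mul(1) dv_refl p_def by metis
qed

text \<open>Two distinct moduli differ by (d + 1) v with d below \<open>b\<close>, and d + 1 divides
  v, so \<open>modulus_cancel\<close> removes the difference. Coprimality is phrased as a
  cancellation law, the form in which \<open>ex_code_below\<close> applies it.\<close>

lemma modulus_coprime:
  assumes v: "\<And>k. k \<prec> b \<Longrightarrow> dv (k \<oplus> \<one>) v" and "x \<prec> b" "y \<prec> b" "x \<noteq> y"
    and dv: "dv (modulus v x) (u \<otimes> modulus v y)"
  shows "dv (modulus v x) u"
proof -
  consider d where "y = x \<oplus> (d \<oplus> \<one>)" | d where "x = y \<oplus> (d \<oplus> \<one>)"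
    using linear[of x y] assms(4) less_iff by metis
  then obtain d where d: "d \<prec> b" "y = x \<oplus> (d \<oplus> \<one>) \<or> x = y \<oplus> (d \<oplus> \<one>)"
  proof cases
    case (1 d)
    have "d \<prec> y" unfolding less_iff 1 by (metis add_Suc add_commute)
    then show ?thesis using 1 assms(3) less_trans that by blast
  next
    case (2 d)
    have "d \<prec> x" unfolding less_iff 2 by (metis add_Suc add_commute)
    then show ?thesis using 2 assms(2) less_trans that by blast
  qed
  obtain w where w: "v = (d \<oplus> \<one>) \<otimes> w" using v[OF d(1)] dv_def by blast
  have "dv (modulus v x) (u \<otimes> ((d \<oplus> \<one>) \<otimes> v))"
    using d(2)
  proof
    assume "y = x \<oplus> (d \<oplus> \<one>)"
    then have "u \<otimes> modulus v x \<oplus> u \<otimes> ((d \<oplus> \<one>) \<otimes> v) = u \<otimes> modulus v y"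
      by (simp add: modulus_def semiring)
    then show ?thesis using dv_add_right dv dv_mul(2) dv_refl by metis
  next
    assume "x = y \<oplus> (d \<oplus> \<one>)"
    then have "u \<otimes> modulus v y \<oplus> u \<otimes> ((d \<oplus> \<one>) \<otimes> v) = u \<otimes> modulus v x"
      by (simp add: modulus_def semiring)
    then show ?thesis using dv_add_right dv dv_mul(2) dv_refl by metis
  qed
  then show ?thesis using modulus_cancel[OF w] by blast
qed

text \<open>Plays the role of the factorial of \<open>b\<close>, which is not a term. The shape
  \<open>w \<oplus> \<one>\<close> keeps the multiple nonzero; from 0 every modulus would be
  1.\<close>

lemma ex_common_multiple: "\<exists>w. \<forall>k. k \<prec> b \<longrightarrow> dv (k \<oplus> \<one>) (w \<oplus> \<one>)"
proof (induction b rule: number_induct, unfold dv_def, intro adef_intros, fold dv_def)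
  show "\<exists>w. \<forall>k. k \<prec> \<zero> \<longrightarrow> dv (k \<oplus> \<one>) (w \<oplus> \<one>)" by (simp add: not_less_zero)
  fix b assume "\<exists>w. \<forall>k. k \<prec> b \<longrightarrow> dv (k \<oplus> \<one>) (w \<oplus> \<one>)"
  then obtain w where w: "\<And>k. k \<prec> b \<Longrightarrow> dv (k \<oplus> \<one>) (w \<oplus> \<one>)" by blast
  have "(w \<otimes> b \<oplus> w \<oplus> b) \<oplus> \<one> = (w \<oplus> \<one>) \<otimes> (b \<oplus> \<one>)" by (simp add: semiring)
  then have "dv (k \<oplus> \<one>) ((w \<otimes> b \<oplus> w \<oplus> b) \<oplus> \<one>)" if "k \<prec> b \<oplus> \<one>" for k
    using that w dv_mul dv_refl less_Suc by metis
  then show "\<exists>w. \<forall>k. k \<prec> b \<oplus> \<one> \<longrightarrow> dv (k \<oplus> \<one>) (w \<oplus> \<one>)" by blast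
qed

lemma not_modulus_dv_one: "\<not> dv (modulus (w \<oplus> \<one>) x) \<one>"
proof
  assume "dv (modulus (w \<oplus> \<one>) x) \<one>"
  then obtain r where r: "\<one> = modulus (w \<oplus> \<one>) x \<otimes> r" unfolding dv_def by blast
  have "\<one> \<noteq> \<zero>" by (metis zero_add Suc_neq_zero)
  then obtain s where s: "r = s \<oplus> \<one>" using r zero_or_Suc mul_zero by metis
  \<comment> \<open>The modulus is (x + 1)(w + 1) + 1, which is at least 2; its product with s + 1
    therefore exceeds 1 by the displayed successor.\<close>
  have "modulus (w \<oplus> \<one>) x \<otimes> r =
      \<one> \<oplus> ((x \<otimes> w \<otimes> s \<oplus> x \<otimes> w \<oplus> x \<otimes> s \<oplus> x \<oplus> w \<otimes> s \<oplus> w \<oplus> s \<oplus> s) \<oplus> \<one>)"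
    unfolding s modulus_def by (simp add: semiring)
  then show False using r add_Suc_neq by metis
qed

text \<open>\<open>u\<close> is the product of the moduli of those elements of \<open>A\<close>
  below \<open>b\<close> that precede i, starting from 1. Induction on i multiplies in one factor at
  a time, and coprimality ensures that a factor brings in no other element.\<close>

lemma ex_code_below:
  assumes w: "\<And>k. k \<prec> b \<Longrightarrow> dv (k \<oplus> \<one>) (w \<oplus> \<one>)" and A: "A \<in> range S"
  shows "\<exists>u. \<forall>x. x \<prec> b \<longrightarrow> (dv (modulus (w \<oplus> \<one>) x) u \<longleftrightarrow> x \<in> A \<and> x \<prec> i)"
proof (induction i rule: number_induct, unfold dv_def modulus_def, intro adef_intros adef_mem[OF A], fold dv_def modulus_def)
  show "\<exists>u. \<forall>x. x \<prec> b \<longrightarrow> (dv (modulus (w \<oplus> \<one>) x) u \<longleftrightarrow> x \<in> A \<and> x \<prec> \<zero>)"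
    using not_modulus_dv_one not_less_zero by blast
  fix i assume "\<exists>u. \<forall>x. x \<prec> b \<longrightarrow> (dv (modulus (w \<oplus> \<one>) x) u \<longleftrightarrow> x \<in> A \<and> x \<prec> i)"
  then obtain u where u: "\<And>x. x \<prec> b \<Longrightarrow> dv (modulus (w \<oplus> \<one>) x) u \<longleftrightarrow> x \<in> A \<and> x \<prec> i" by blast
  show "\<exists>u. \<forall>x. x \<prec> b \<longrightarrow> (dv (modulus (w \<oplus> \<one>) x) u \<longleftrightarrow> x \<in> A \<and> x \<prec> i \<oplus> \<one>)"
  proof (cases "i \<prec> b \<and> i \<in> A")
    case False
    then have "\<forall>x. x \<prec> b \<longrightarrow> (dv (modulus (w \<oplus> \<one>) x) u \<longleftrightarrow> x \<in> A \<and> x \<prec> i \<oplus> \<one>)"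
      using u less_Suc by blast
    then show ?thesis ..
  next
    case True
    have "dv (modulus (w \<oplus> \<one>) x) (u \<otimes> modulus (w \<oplus> \<one>) i) \<longleftrightarrow> x \<in> A \<and> x \<prec> i \<oplus> \<one>" if "x \<prec> b" for x
    proof (cases "x = i")
      case True
      then show ?thesis using \<open>i \<prec> b \<and> i \<in> A\<close> less_Suc dv_mul(2) dv_refl by blast
    next
      case False
      then have "dv (modulus (w \<oplus> \<one>) x) (u \<otimes> modulus (w \<oplus> \<one>) i) \<longleftrightarrow> dv (modulus (w \<oplus> \<one>) x) u"
        using modulus_coprime[OF w that] True dv_mul(1) by blast
      then show ?thesis using u[OF that] False less_Suc by blast
    qed
    then show ?thesis by blast
  qed
qed

text \<open>The code stores a bound \<open>b\<close>, the beta parameter \<open>v\<close> and the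
  product \<open>u\<close>. The bound belongs to the code so that every number decodes to a bounded
  set of the model; numbers of another shape decode to the empty set.\<close>

definition dec :: "'a \<Rightarrow> 'a set" where
  "dec c = {z. \<exists>b v u. c = pr b (pr v u) \<and> z \<prec> b \<and> dv (modulus v z) u}"

lemma ex_code:
  assumes A: "A \<in> range S" and b: "\<And>x. x \<in> A \<Longrightarrow> x \<prec> b"
  shows "\<exists>c. dec c = A"
proof -
  obtain w where w: "\<And>k. k \<prec> b \<Longrightarrow> dv (k \<oplus> \<one>) (w \<oplus> \<one>)" using ex_common_multiple by blast
  obtain u where "\<And>x. x \<prec> b \<Longrightarrow> dv (modulus (w \<oplus> \<one>) x) u \<longleftrightarrow> x \<in> A \<and> x \<prec> b"
    using ex_code_below[OF w A] by blast
  then have "dec (pr b (pr (w \<oplus> \<one>) u)) = A"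
    using b unfolding dec_def by auto
  then show ?thesis ..
qed

lemma dec_bounded: "\<exists>b. \<forall>z\<in>dec c. z \<prec> b"
  unfolding dec_def by (cases "\<exists>b v u. c = pr b (pr v u)") auto

lemma adef_dec: "tdef f \<Longrightarrow> tdef g \<Longrightarrow> adef (\<lambda>e. f e \<in> dec (g e))"
  by (erule (1) adef_2[rotated])
    (unfold dec_def dv_def modulus_def mem_Collect_eq, intro adef_intros tdef_pr)

lemma dec_in_range: "dec c \<in> range S"
  using comprehension[of "\<lambda>z. z \<in> dec c"] by (simp add: adef_dec adef_intros)

end


section \<open>Recursion in models of arithmetical comprehension\<close>

context aca_model
begin

lemma ex_code_empty: "\<exists>c. dec c = {}"
  using ex_code[of "{}"] comprehension[of "\<lambda>_. False"] by (simp add: adef_const)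

lemma ex_code_insert: "\<exists>c'. dec c' = insert z (dec c)"
proof -
  obtain b where b: "\<And>x. x \<in> dec c \<Longrightarrow> x \<prec> b" using dec_bounded by blast
  have "insert z (dec c) = {x. x = z \<or> x \<in> dec c}" by auto
  moreover have "{x. x = z \<or> x \<in> dec c} \<in> range S"
    by (intro comprehension adef_intros adef_dec)
  moreover have "z \<prec> b \<oplus> (z \<oplus> \<one>)" unfolding less_iff by (metis add_assoc add_commute)
  moreover have "x \<prec> b \<oplus> (z \<oplus> \<one>)" if "x \<in> dec c" for x
    using b[OF that] less_leq_trans leq_add by blast
  ultimately show ?thesis by (intro ex_code[where b = "b \<oplus> (z \<oplus> \<one>)"]) auto
qed

lemma ex_code_Un: "\<exists>c. dec c = dec c1 \<union> dec c2"
proof -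
  obtain b1 b2 where b: "\<And>x. x \<in> dec c1 \<Longrightarrow> x \<prec> b1" "\<And>x. x \<in> dec c2 \<Longrightarrow> x \<prec> b2"
    using dec_bounded by metis
  have "dec c1 \<union> dec c2 = {x. x \<in> dec c1 \<or> x \<in> dec c2}" by auto
  moreover have "{x. x \<in> dec c1 \<or> x \<in> dec c2} \<in> range S"
    by (intro comprehension adef_intros adef_dec)
  ultimately show ?thesis using b less_leq_trans leq_add
    by (intro ex_code[where b = "b1 \<oplus> b2"]) (auto, blast+)
qed

text \<open>Iterates a definable partial function by means of number-coded approximations.
  \<open>P\<close> is an invariant that keeps \<open>G\<close> applicable, and the four clauses
  about \<open>F\<close> are made to match \<open>is_function\<close> and
  \<open>descending\<close>.\<close>

lemma ex_sequence:
  assumes G: "adef (\<lambda>e. G (e 0) (e 1))" and P: "adef (\<lambda>e. P (e 0))"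
    and unique: "\<forall>x y y'. G x y \<and> G x y' \<longrightarrow> y = y'"
    and step: "\<forall>x. P x \<longrightarrow> (\<exists>y. G x y \<and> P y)" and "P a0"
  shows "\<exists>F\<in>range S. (\<forall>z\<in>F. \<exists>n a. z = pr n a) \<and> (\<forall>n. \<exists>a. pr n a \<in> F) \<and>
    (\<forall>n a b. pr n a \<in> F \<and> pr n b \<in> F \<longrightarrow> a = b) \<and>
    (\<forall>n a b. pr n a \<in> F \<and> pr (n \<oplus> \<one>) b \<in> F \<longrightarrow> G a b)"
proof -
  \<comment> \<open>Each entry is only asked to be initial or to follow from an entry of the same
    code. Uniqueness of the values comes out of \<open>eq\<close>, which also compares different
    codes.\<close>
  define approx where "approx c \<longleftrightarrow> (\<forall>i a. pr i a \<in> dec c \<longrightarrow>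
    i = \<zero> \<and> a = a0 \<or> (\<exists>i' a'. i = i' \<oplus> \<one> \<and> pr i' a' \<in> dec c \<and> G a' a))" for c
  have "adef (\<lambda>e. approx (e 0))"
    unfolding approx_def by (intro adef_intros adef_dec tdef_pr adef_2[OF G])
  note approx_intro = adef_intros adef_dec tdef_pr adef_1[OF this] adef_1[OF P]
  have eq: "\<forall>c c' a a'. approx c \<and> approx c' \<and> pr n a \<in> dec c \<and> pr n a' \<in> dec c' \<longrightarrow> a = a'" for n
  proof (induction n rule: number_induct, intro approx_intro)
    case zero
    then show ?case unfolding approx_def by (metis Suc_neq_zero)
  next
    case (Suc n)
    show ?case
    proof (intro allI impI, elim conjE)
      fix c c' a a'
      assume *: "approx c" "approx c'" "pr (n \<oplus> \<one>) a \<in> dec c" "pr (n \<oplus> \<one>) a' \<in> dec c'"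
      obtain b where "pr n b \<in> dec c" "G b a"
        using *(1,3) unfolding approx_def by (metis Suc_neq_zero Suc_inject)
      moreover obtain b' where "pr n b' \<in> dec c'" "G b' a'"
        using *(2,4) unfolding approx_def by (metis Suc_neq_zero Suc_inject)
      ultimately show "a = a'" using Suc *(1,2) unique by metis
    qed
  qed
  have total: "\<exists>c a. approx c \<and> pr n a \<in> dec c \<and> P a" for n
  proof (induction n rule: number_induct, intro approx_intro)
    case zero
    obtain c0 c where "dec c0 = {}" "dec c = insert (pr \<zero> a0) (dec c0)"
      using ex_code_empty ex_code_insert by metis
    then have "approx c" "pr \<zero> a0 \<in> dec c" unfolding approx_def by auto
    then show ?case using \<open>P a0\<close> by blast
  next
    case (Suc n)
    then obtain c a b where c: "approx c" "pr n a \<in> dec c" "G a b" "P b" using step by blast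
    obtain c' where c': "dec c' = insert (pr (n \<oplus> \<one>) b) (dec c)" using ex_code_insert by metis
    have "approx c'"
      unfolding approx_def
    proof (intro allI impI)
      fix i a' assume "pr i a' \<in> dec c'"
      then consider "i = n \<oplus> \<one>" "a' = b" | "pr i a' \<in> dec c" unfolding c' by auto
      then show "i = \<zero> \<and> a' = a0 \<or> (\<exists>i' a''. i = i' \<oplus> \<one> \<and> pr i' a'' \<in> dec c' \<and> G a'' a')"
        using c unfolding approx_def c' by cases blast+
    qed
    then show ?case using c' c(4) by blast
  qed
  define F where "F = {z. \<exists>n a. z = pr n a \<and> (\<exists>c. approx c \<and> z \<in> dec c)}"
  have F: "pr n a \<in> F \<longleftrightarrow> (\<exists>c. approx c \<and> pr n a \<in> dec c)" for n a
    unfolding F_def by auto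
  show ?thesis
  proof (intro bexI[of _ F] conjI ballI allI impI; (elim conjE)?)
    show "F \<in> range S" unfolding F_def by (intro comprehension approx_intro)
    show "\<exists>n a. z = pr n a" if "z \<in> F" for z using that unfolding F_def by blast
    show "\<exists>a. pr n a \<in> F" for n using total F by blast
    show eqF: "a = b" if ab: "pr n a \<in> F" "pr n b \<in> F" for n a b
    proof -
      obtain c c' where "approx c" "pr n a \<in> dec c" "approx c'" "pr n b \<in> dec c'"
        using ab F by metis
      then show ?thesis using eq[rule_format, of c c' n a b] by simp
    qed
    show "G a b" if ab: "pr n a \<in> F" "pr (n \<oplus> \<one>) b \<in> F" for n a b
    proof -
      obtain c where c: "approx c" "pr (n \<oplus> \<one>) b \<in> dec c" using ab(2) F by metis
      then obtain a' where a': "pr n a' \<in> dec c" "G a' b"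
        unfolding approx_def by (metis Suc_neq_zero Suc_inject)
      then have "pr n a' \<in> F" using F c(1) by metis
      then have "a = a'" by (rule eqF[OF ab(1)])
      then show ?thesis using a'(2) by simp
    qed
  qed
qed

section \<open>Orders and arithmetical transfinite induction\<close>

definition fld :: "'a set \<Rightarrow> 'a \<Rightarrow> bool" where
  "fld X a \<longleftrightarrow> pr a a \<in> X"

definition lt :: "'a set \<Rightarrow> 'a \<Rightarrow> 'a \<Rightarrow> bool" where
  "lt X a b \<longleftrightarrow> pr a b \<in> X \<and> pr b a \<notin> X"

lemma ev_pair [simp]: "ev \<eta> (pair s t) = pr (ev \<eta> s) (ev \<eta> t)"
  by (simp add: pair_def pr_def)

lemma sat_in_field [simp]: "sat \<eta> r (in_field i t) \<longleftrightarrow> fld (r i) (ev \<eta> t)"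
  by (simp add: in_field_def fld_def)

lemma sat_less_in [simp]: "sat \<eta> r (less_in i s t) \<longleftrightarrow> lt (r i) (ev \<eta> s) (ev \<eta> t)"
  by (simp add: less_in_def le_in_def lt_def)

lemma adef_fld: "X \<in> range S \<Longrightarrow> tdef f \<Longrightarrow> adef (\<lambda>e. fld X (f e))"
  unfolding fld_def by (intro adef_intros adef_mem tdef_pr)

lemma adef_lt: "X \<in> range S \<Longrightarrow> tdef f \<Longrightarrow> tdef g \<Longrightarrow> adef (\<lambda>e. lt X (f e) (g e))"
  unfolding lt_def by (intro adef_intros adef_mem tdef_pr)

lemma sat_LO_lt_fld: "sat \<eta> r (LO i) \<Longrightarrow> lt (r i) a b \<Longrightarrow> fld (r i) a"
  unfolding LO_def Let_def le_in_def lt_def by (auto simp: numeral_2_eq_2)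

lemma sat_LO_cong: "r i = r' i' \<Longrightarrow> sat \<eta> r (LO i) \<longleftrightarrow> sat \<eta>' r' (LO i')"
  by (simp add: LO_def Let_def le_in_def is_relation_def numeral_2_eq_2)

text \<open>If there were a counterexample, each counterexample would have another one below it in
  the order, and stepping to the numerically least of these would give a descending
  sequence.\<close>

lemma transfinite_induct:
  assumes WO: "sat \<eta> r (WO 0)" and X: "r 0 = X" "X \<in> range S"
    and P: "adef (\<lambda>e. P (e 0))"
    and step: "\<And>j. fld X j \<Longrightarrow> (\<And>a. lt X a j \<Longrightarrow> P a) \<Longrightarrow> P j"
    and "fld X j"
  shows "P j"
proof (rule ccontr)
  assume "\<not> P j"
  have LO: "lt X a b \<Longrightarrow> fld X a" for a b
    using WO sat_LO_lt_fld[of \<eta> r 0] X(1) unfolding WO_def by simp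
  define B where "B x \<longleftrightarrow> fld X x \<and> \<not> P x" for x
  have B: "adef (\<lambda>e. B (e 0))"
    unfolding B_def by (intro adef_intros adef_fld adef_1[OF P] X(2))
  \<comment> \<open>Taking the numerically least candidate makes the step single-valued while
    keeping it arithmetical.\<close>
  define G where "G x y \<longleftrightarrow> (B y \<and> lt X y x) \<and> (\<forall>z. z \<prec> y \<longrightarrow> \<not> (B z \<and> lt X z x))" for x y
  have G: "adef (\<lambda>e. G (e 0) (e 1))"
    unfolding G_def by (intro adef_intros adef_lt adef_1[OF B] X(2))
  have total: "\<forall>x. B x \<longrightarrow> (\<exists>y. G x y \<and> B y)"
  proof (intro allI impI)
    fix x assume "B x"
    show "\<exists>y. G x y \<and> B y"
    proof (rule ccontr)
      assume "\<not> ?thesis"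
      then have no: "\<not> G x y" for y unfolding G_def by blast
      have "\<not> (B y \<and> lt X y x)" for y
      \<comment> \<open>Least number principle: if no candidate is least, course-of-values induction
        shows that there is none.\<close>
      proof (rule less_induct[where P = "\<lambda>y. \<not> (B y \<and> lt X y x)"])
        show "adef (\<lambda>e. \<not> (B (e 0) \<and> lt X (e 0) x))"
          by (intro adef_intros adef_lt adef_1[OF B] X(2))
      qed (use no G_def in blast)
      then have "P x" using step \<open>B x\<close> LO unfolding B_def by blast
      then show False using \<open>B x\<close> B_def by blast
    qed
  qed
  have unique: "\<forall>x y y'. G x y \<and> G x y' \<longrightarrow> y = y'"
    using linear unfolding G_def by blast
  have "B j" using \<open>\<not> P j\<close> \<open>fld X j\<close> B_def by blast
  obtain F where F: "F \<in> range S" "\<forall>z\<in>F. \<exists>n a. z = pr n a" "\<forall>n. \<exists>a. pr n a \<in> F"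
    "\<forall>n a b. pr n a \<in> F \<and> pr n b \<in> F \<longrightarrow> a = b"
    "\<forall>n a b. pr n a \<in> F \<and> pr (n \<oplus> \<one>) b \<in> F \<longrightarrow> G a b"
    using ex_sequence[OF G B unique total \<open>B j\<close>] by (elim bexE conjE) (rule that)
  obtain k where k: "F = S k" using F(1) by blast
  have "\<not> sat \<eta> (case_nat (S k) r) (descending (Suc 0) 0)"
    using WO unfolding WO_def by simp
  moreover have "sat \<eta> (case_nat (S k) r) (descending (Suc 0) 0)"
    unfolding descending_def is_function_def is_relation_def Let_def k[symmetric]
    using F(2-5) by (auto simp: numeral_2_eq_2 X(1) G_def)
  ultimately show False by blast
qed

section \<open>Use of bounded formulas\<close>

lemma ev_subst_bound:
  assumes "x \<prec> ev \<eta> b" "z \<prec> ev (case_nat x \<eta>) t"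
  shows "z \<prec> ev \<eta> (subst_tm (case_nat b Var) t)"
proof -
  \<comment> \<open>Monotonicity of \<open>t\<close> majorizes its values at all x below
    \<open>b\<close> by its value at \<open>b\<close>, so a bounded quantifier keeps the use bounded
    by a term.\<close>
  have "ev (case_nat x \<eta>) t \<preceq> ev (\<lambda>i. ev \<eta> (case_nat b Var i)) t"
    using less_imp_leq[OF assms(1)] by (intro ev_mono) (auto simp: leq_refl split: nat.split)
  then show ?thesis using less_leq_trans assms(2) by (simp add: ev_subst_tm)
qed

text \<open>
  A \<open>\<Delta>\<^sup>0\<^sub>0\<close> formula queries its set variable 0 only below the value of a term, because terms are
  monotone in all their variables.
\<close>

lemma Delta00_use:
  assumes "Delta00 A"
  shows "\<exists>t. \<forall>\<eta> r r'. (\<forall>z. z \<prec> ev \<eta> t \<longrightarrow> (z \<in> r 0 \<longleftrightarrow> z \<in> r' 0)) \<and> (\<forall>i. r (Suc i) = r' (Suc i))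
    \<longrightarrow> (sat \<eta> r A \<longleftrightarrow> sat \<eta> r' A)"
  using assms
proof (induction A rule: Delta00.induct)
  case (4 t X)
  \<comment> \<open>The atom queries the value of \<open>t\<close> itself and the bound is strict,
    hence the added one.\<close>
  have "ev \<eta> t \<prec> ev \<eta> (Add t One)" for \<eta>
    by (simp add: less_Suc)
  then show ?case by (intro exI[of _ "Add t One"]) (cases X; simp)
next
  case (5 A B)
  then obtain s t where st:
    "\<forall>\<eta> r r'. (\<forall>z. z \<prec> ev \<eta> s \<longrightarrow> (z \<in> r 0 \<longleftrightarrow> z \<in> r' 0)) \<and> (\<forall>i. r (Suc i) = r' (Suc i))
      \<longrightarrow> (sat \<eta> r A \<longleftrightarrow> sat \<eta> r' A)"
    "\<forall>\<eta> r r'. (\<forall>z. z \<prec> ev \<eta> t \<longrightarrow> (z \<in> r 0 \<longleftrightarrow> z \<in> r' 0)) \<and> (\<forall>i. r (Suc i) = r' (Suc i))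
      \<longrightarrow> (sat \<eta> r B \<longleftrightarrow> sat \<eta> r' B)"
    by (elim exE) (rule that)
  have less: "z \<prec> ev \<eta> (Add s t)" if "z \<prec> ev \<eta> s \<or> z \<prec> ev \<eta> t" for z \<eta>
    using that less_leq_trans leq_add by auto
  show ?case
  proof (intro exI[of _ "Add s t"] allI impI)
    fix \<eta> r r'
    assume *: "(\<forall>z. z \<prec> ev \<eta> (Add s t) \<longrightarrow> (z \<in> r 0 \<longleftrightarrow> z \<in> r' 0)) \<and> (\<forall>i. r (Suc i) = r' (Suc i))"
    have "sat \<eta> r A \<longleftrightarrow> sat \<eta> r' A" using less * by (intro st(1)[rule_format]) blast
    moreover have "sat \<eta> r B \<longleftrightarrow> sat \<eta> r' B" using less * by (intro st(2)[rule_format]) blast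
    ultimately show "sat \<eta> r (Imp A B) \<longleftrightarrow> sat \<eta> r' (Imp A B)" by simp
  qed
next
  case (6 A b)
  then obtain t where t: "\<forall>\<eta> r r'. (\<forall>z. z \<prec> ev \<eta> t \<longrightarrow> (z \<in> r 0 \<longleftrightarrow> z \<in> r' 0)) \<and>
      (\<forall>i. r (Suc i) = r' (Suc i)) \<longrightarrow> (sat \<eta> r A \<longleftrightarrow> sat \<eta> r' A)"
    by (elim exE) (rule that)
  show ?case
  proof (intro exI[of _ "subst_tm (case_nat b Var) t"] allI impI)
    fix \<eta> r r'
    assume *: "(\<forall>z. z \<prec> ev \<eta> (subst_tm (case_nat b Var) t) \<longrightarrow> (z \<in> r 0 \<longleftrightarrow> z \<in> r' 0)) \<and>
      (\<forall>i. r (Suc i) = r' (Suc i))"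
    have "sat (case_nat x \<eta>) r A \<longleftrightarrow> sat (case_nat x \<eta>) r' A" if "x \<prec> ev \<eta> b" for x
      using ev_subst_bound[OF that] * by (intro t[rule_format]) blast
    then show "sat \<eta> r (AllN (Imp (Less (Var 0) (lift_tm b)) A)) \<longleftrightarrow>
        sat \<eta> r' (AllN (Imp (Less (Var 0) (lift_tm b)) A))"
      by auto
  qed
next
  case (7 A b)
  then obtain t where t: "\<forall>\<eta> r r'. (\<forall>z. z \<prec> ev \<eta> t \<longrightarrow> (z \<in> r 0 \<longleftrightarrow> z \<in> r' 0)) \<and>
      (\<forall>i. r (Suc i) = r' (Suc i)) \<longrightarrow> (sat \<eta> r A \<longleftrightarrow> sat \<eta> r' A)"
    by (elim exE) (rule that)
  show ?case
  proof (intro exI[of _ "subst_tm (case_nat b Var) t"] allI impI)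
    fix \<eta> r r'
    assume *: "(\<forall>z. z \<prec> ev \<eta> (subst_tm (case_nat b Var) t) \<longrightarrow> (z \<in> r 0 \<longleftrightarrow> z \<in> r' 0)) \<and>
      (\<forall>i. r (Suc i) = r' (Suc i))"
    have "sat (case_nat x \<eta>) r A \<longleftrightarrow> sat (case_nat x \<eta>) r' A" if "x \<prec> ev \<eta> b" for x
      using ev_subst_bound[OF that] * by (intro t[rule_format]) blast
    then show "sat \<eta> r (ExN (And (Less (Var 0) (lift_tm b)) A)) \<longleftrightarrow>
        sat \<eta> r' (ExN (And (Less (Var 0) (lift_tm b)) A))"
      by auto
  qed
qed auto

end

lemma Delta00_arithmetical: "Delta00 A \<Longrightarrow> arithmetical A"
  by (induction rule: Delta00.induct) auto

text \<open>
  \<open>\<Theta> x n Z\<close> and \<open>\<Theta>' x n Z\<close> say that \<open>x\<close> is a witness of \<open>\<phi>(n, Z)\<close> and \<open>\<psi>(n, Z)\<close>, and \<open>qbound x n\<close>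
  bounds the queries to \<open>Z\<close> in both.
\<close>

locale etr_model = aca_model zero one add mul less S name
  for zero one :: 'a and add mul less S name +
  fixes X :: "'a set" and \<Theta> \<Theta>' :: "'a \<Rightarrow> 'a \<Rightarrow> 'a set \<Rightarrow> bool" and qbound :: "'a \<Rightarrow> 'a \<Rightarrow> 'a"
  assumes X: "X \<in> range S"
    and wo_induct: "\<And>P j. adef (\<lambda>e. P (e 0)) \<Longrightarrow>
      (\<And>j. fld X j \<Longrightarrow> (\<And>a. lt X a j \<Longrightarrow> P a) \<Longrightarrow> P j) \<Longrightarrow> fld X j \<Longrightarrow> P j"
    and adef_\<Theta>: "\<And>f g R. tdef f \<Longrightarrow> tdef g \<Longrightarrow> adef (\<lambda>e. e 0 \<in> R (\<lambda>k. e (Suc k))) \<Longrightarrow>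
      adef (\<lambda>e. \<Theta> (f e) (g e) (R e))"
    and adef_\<Theta>': "\<And>f g R. tdef f \<Longrightarrow> tdef g \<Longrightarrow> adef (\<lambda>e. e 0 \<in> R (\<lambda>k. e (Suc k))) \<Longrightarrow>
      adef (\<lambda>e. \<Theta>' (f e) (g e) (R e))"
    and tdef_qbound: "\<And>f g. tdef f \<Longrightarrow> tdef g \<Longrightarrow> tdef (\<lambda>e. qbound (f e) (g e))"
    and qbound_\<Theta>: "\<And>x n Z Z'. (\<And>z. z \<prec> qbound x n \<Longrightarrow> z \<in> Z \<longleftrightarrow> z \<in> Z') \<Longrightarrow> \<Theta> x n Z \<longleftrightarrow> \<Theta> x n Z'"
    and qbound_\<Theta>': "\<And>x n Z Z'. (\<And>z. z \<prec> qbound x n \<Longrightarrow> z \<in> Z \<longleftrightarrow> z \<in> Z') \<Longrightarrow> \<Theta>' x n Z \<longleftrightarrow> \<Theta>' x n Z'"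
    and complementary: "\<And>n Z. Z \<in> range S \<Longrightarrow> (\<exists>x. \<Theta> x n Z) \<longleftrightarrow> \<not> (\<exists>x. \<Theta>' x n Z)"
begin

section \<open>Certificates, their agreement, and the solution of the recursion\<close>

definition sec :: "'a set \<Rightarrow> 'a \<Rightarrow> 'a set" where
  "sec V j = {z. \<exists>m a. z = pr m a \<and> lt X a j \<and> z \<in> V}"

text \<open>
  \<open>D\<close> is a set of pairs for which the recursion has been decided, and \<open>V\<close> the set of those with a
  positive answer.
\<close>

definition justified :: "'a set \<Rightarrow> 'a set \<Rightarrow> 'a \<Rightarrow> 'a \<Rightarrow> bool" where
  "justified D V n j \<longleftrightarrow> (\<exists>x. (\<forall>m a. pr m a \<prec> qbound x n \<and> lt X a j \<longrightarrow> pr m a \<in> D) \<and>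
    (pr n j \<in> V \<and> \<Theta> x n (sec V j) \<or> pr n j \<notin> V \<and> \<Theta>' x n (sec V j)))"

text \<open>Closed under its own queries: whatever a witness asks below \<open>j\<close> is decided
  inside \<open>D\<close>. So an answer can be checked from \<open>D\<close> and \<open>V\<close>
  alone, and undecided pairs never influence it.\<close>

definition cert :: "'a set \<Rightarrow> 'a set \<Rightarrow> bool" where
  "cert D V \<longleftrightarrow> (\<forall>z. z \<in> V \<longrightarrow> z \<in> D) \<and> (\<forall>n j. pr n j \<in> D \<longrightarrow> fld X j \<and> justified D V n j)"

lemma pr_in_sec [simp]: "pr m a \<in> sec V j \<longleftrightarrow> lt X a j \<and> pr m a \<in> V"
  unfolding sec_def by auto

lemma sec_in_range: "V \<in> range S \<Longrightarrow> sec V j \<in> range S"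
  unfolding sec_def by (intro comprehension adef_intros tdef_pr adef_lt adef_mem X)

lemma adef_sec: "tdef f \<Longrightarrow> tdef g \<Longrightarrow> tdef h \<Longrightarrow> adef (\<lambda>e. f e \<in> sec (dec (g e)) (h e))"
  by (rule adef_3[of "\<lambda>x y z. x \<in> sec (dec y) z"])
    (unfold sec_def mem_Collect_eq, intro adef_intros tdef_pr adef_lt adef_dec X)

lemma adef_cert: "tdef f \<Longrightarrow> tdef g \<Longrightarrow> adef (\<lambda>e. cert (dec (f e)) (dec (g e)))"
  by (rule adef_2[of "\<lambda>x y. cert (dec x) (dec y)"])
    (unfold cert_def justified_def,
      intro adef_intros tdef_pr tdef_qbound adef_lt adef_fld adef_dec adef_sec adef_\<Theta> adef_\<Theta>' X)

lemmas cert_intros = adef_intros tdef_pr tdef_qbound adef_lt adef_fld adef_dec adef_cert X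

text \<open>A witness sees a section only at pairs under its query bound whose second component
  precedes \<open>j\<close>.\<close>

lemma witness_agree:
  assumes "\<And>m a. pr m a \<prec> qbound x n \<Longrightarrow> lt X a j \<Longrightarrow> pr m a \<in> V \<longleftrightarrow> pr m a \<in> V'"
  shows "\<Theta> x n (sec V j) \<longleftrightarrow> \<Theta> x n (sec V' j)" "\<Theta>' x n (sec V j) \<longleftrightarrow> \<Theta>' x n (sec V' j)"
proof -
  have sec: "z \<in> sec V j \<longleftrightarrow> z \<in> sec V' j" if "z \<prec> qbound x n" for z
    using assms that unfolding sec_def by blast
  show "\<Theta> x n (sec V j) \<longleftrightarrow> \<Theta> x n (sec V' j)" using sec by (rule qbound_\<Theta>)
  show "\<Theta>' x n (sec V j) \<longleftrightarrow> \<Theta>' x n (sec V' j)" using sec by (rule qbound_\<Theta>')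
qed

text \<open>The old witness still works: all its queries lie in \<open>D\<close>, where the answers
  are unchanged.\<close>

lemma justified_mono:
  assumes "justified D V n j" and "pr n j \<in> D" and "D \<subseteq> D'" and "\<And>m a. pr m a \<in> D \<Longrightarrow> pr m a \<in> V' \<longleftrightarrow> pr m a \<in> V"
  shows "justified D' V' n j"
proof -
  obtain x where x: "\<And>m a. pr m a \<prec> qbound x n \<Longrightarrow> lt X a j \<Longrightarrow> pr m a \<in> D"
    "pr n j \<in> V \<and> \<Theta> x n (sec V j) \<or> pr n j \<notin> V \<and> \<Theta>' x n (sec V j)"
    using assms(1) unfolding justified_def by blast
  have "pr m a \<in> V' \<longleftrightarrow> pr m a \<in> V" if "pr m a \<prec> qbound x n" "lt X a j" for m a
    using that x(1) assms(4) by blast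
  note agree = witness_agree[OF this]
  have "pr n j \<in> V' \<longleftrightarrow> pr n j \<in> V" using assms(2) by (rule assms(4))
  then have "pr n j \<in> V' \<and> \<Theta> x n (sec V' j) \<or> pr n j \<notin> V' \<and> \<Theta>' x n (sec V' j)"
    using x(2) by (simp only: agree)
  moreover have "\<forall>m a. pr m a \<prec> qbound x n \<and> lt X a j \<longrightarrow> pr m a \<in> D'"
    using x(1) assms(3) by blast
  ultimately show ?thesis unfolding justified_def by blast
qed

text \<open>
  If two certificates disagreed at a pair but not below, then the union of their sections would
  satisfy both \<open>\<phi>\<close> and \<open>\<psi>\<close>.
\<close>

lemma cert_agree_step:
  assumes "cert D V" "cert D' V'" "V \<in> range S" "V' \<in> range S"
    and below: "\<And>m a. lt X a j \<Longrightarrow> pr m a \<in> D \<Longrightarrow> pr m a \<in> D' \<Longrightarrow> pr m a \<in> V \<longleftrightarrow> pr m a \<in> V'"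
    and "pr n j \<in> D" "pr n j \<in> D'" "pr n j \<in> V"
  shows "pr n j \<in> V'"
proof (rule ccontr)
  assume "pr n j \<notin> V'"
  have sub: "pr m a \<in> D" if "pr m a \<in> V" for m a using assms(1) that unfolding cert_def by blast
  have sub': "pr m a \<in> D'" if "pr m a \<in> V'" for m a using assms(2) that unfolding cert_def by blast
  have "justified D V n j" using assms(1,6) unfolding cert_def by blast
  then obtain x where x: "\<And>m a. pr m a \<prec> qbound x n \<Longrightarrow> lt X a j \<Longrightarrow> pr m a \<in> D" "\<Theta> x n (sec V j)"
    using \<open>pr n j \<in> V\<close> unfolding justified_def by blast
  have "justified D' V' n j" using assms(2,7) unfolding cert_def by blast
  then obtain x' where x': "\<And>m a. pr m a \<prec> qbound x' n \<Longrightarrow> lt X a j \<Longrightarrow> pr m a \<in> D'" "\<Theta>' x' n (sec V' j)"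
    using \<open>pr n j \<notin> V'\<close> unfolding justified_def by blast
  have "{z. z \<in> V \<or> z \<in> V'} \<in> range S"
    using assms(3,4) by (intro comprehension adef_intros adef_mem)
  then have range: "sec (V \<union> V') j \<in> range S" using sec_in_range by (simp add: Un_def)
  \<comment> \<open>A query of \<open>x\<close> lies in \<open>D\<close>; if \<open>V'\<close>
    contains it, it lies in \<open>D'\<close> as well, and \<open>below\<close> puts it into
    \<open>V\<close>. Thus the union looks like \<open>V\<close> to \<open>x\<close> and,
    symmetrically, like \<open>V'\<close> to \<open>x'\<close>.\<close>
  have "pr m a \<in> V \<longleftrightarrow> pr m a \<in> V \<union> V'" if "pr m a \<prec> qbound x n" "lt X a j" for m a
    using below[OF that(2)] x(1)[OF that] sub'[of m a] by blast
  then have "\<Theta> x n (sec (V \<union> V') j)" using x(2) by (simp only: witness_agree(1)[of x n j V "V \<union> V'"])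
  moreover have "pr m a \<in> V' \<longleftrightarrow> pr m a \<in> V \<union> V'" if "pr m a \<prec> qbound x' n" "lt X a j" for m a
    using below[OF that(2)] x'(1)[OF that] sub[of m a] by blast
  then have "\<Theta>' x' n (sec (V \<union> V') j)" using x'(2) by (simp only: witness_agree(2)[of x' n j V' "V \<union> V'"])
  ultimately show False using complementary[OF range] by blast
qed

lemma cert_agree:
  assumes c: "cert D V" "cert D' V'" and range: "D \<in> range S" "V \<in> range S" "D' \<in> range S" "V' \<in> range S"
    and n: "pr n j \<in> D" "pr n j \<in> D'"
  shows "pr n j \<in> V \<longleftrightarrow> pr n j \<in> V'"
proof -
  have "fld X j" using c(1) n(1) unfolding cert_def by blast
  then have "\<forall>n. pr n j \<in> D \<and> pr n j \<in> D' \<longrightarrow> (pr n j \<in> V \<longleftrightarrow> pr n j \<in> V')"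
  proof (rule wo_induct[where P = "\<lambda>j. \<forall>n. pr n j \<in> D \<and> pr n j \<in> D' \<longrightarrow> (pr n j \<in> V \<longleftrightarrow> pr n j \<in> V')", rotated -1])
    show "adef (\<lambda>e. \<forall>n. pr n (e 0) \<in> D \<and> pr n (e 0) \<in> D' \<longrightarrow> (pr n (e 0) \<in> V \<longleftrightarrow> pr n (e 0) \<in> V'))"
      by (intro cert_intros adef_mem range)
    fix j assume IH: "\<And>a. lt X a j \<Longrightarrow> \<forall>n. pr n a \<in> D \<and> pr n a \<in> D' \<longrightarrow> (pr n a \<in> V \<longleftrightarrow> pr n a \<in> V')"
    have below: "pr m a \<in> V \<longleftrightarrow> pr m a \<in> V'" if "lt X a j" "pr m a \<in> D" "pr m a \<in> D'" for m a
      using IH that by blast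
    have below': "pr m a \<in> V' \<longleftrightarrow> pr m a \<in> V" if "lt X a j" "pr m a \<in> D'" "pr m a \<in> D" for m a
      using IH that by blast
    show "\<forall>n. pr n j \<in> D \<and> pr n j \<in> D' \<longrightarrow> (pr n j \<in> V \<longleftrightarrow> pr n j \<in> V')"
    proof (intro allI impI iffI; elim conjE)
      fix n assume "pr n j \<in> D" "pr n j \<in> D'" "pr n j \<in> V"
      with below show "pr n j \<in> V'" by (rule cert_agree_step[OF c range(2,4)])
    next
      fix n assume "pr n j \<in> D" "pr n j \<in> D'" "pr n j \<in> V'"
      then show "pr n j \<in> V"
        using cert_agree_step[OF c(2,1) range(4,2), of j n] below' by simp
    qed
  qed
  then show ?thesis using n by blast
qed

text \<open>By agreement, the joint answers restricted to either domain are those of that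
  certificate, so all justifications survive.\<close>

lemma cert_Un:
  assumes "cert (dec c) (dec d)" "cert (dec c') (dec d')"
  shows "cert (dec c \<union> dec c') (dec d \<union> dec d')"
  unfolding cert_def
proof (intro conjI allI impI)
  have *: "pr n j \<in> dec d \<longleftrightarrow> pr n j \<in> dec d'" if "pr n j \<in> dec c" "pr n j \<in> dec c'" for n j
    by (rule cert_agree[OF assms dec_in_range dec_in_range dec_in_range dec_in_range that])
  have sub: "dec d \<subseteq> dec c" "dec d' \<subseteq> dec c'" using assms unfolding cert_def by blast+
  show "z \<in> dec c \<union> dec c'" if "z \<in> dec d \<union> dec d'" for z using that sub by blast
  fix n j assume n: "pr n j \<in> dec c \<union> dec c'"
  then show "fld X j" using assms unfolding cert_def by blast
  show "justified (dec c \<union> dec c') (dec d \<union> dec d') n j"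
    using n
  proof
    assume c: "pr n j \<in> dec c"
    then have "justified (dec c) (dec d) n j" using assms(1) unfolding cert_def by blast
    then show ?thesis by (rule justified_mono[OF _ c]) (use * sub in blast)+
  next
    assume c': "pr n j \<in> dec c'"
    then have "justified (dec c') (dec d') n j" using assms(2) unfolding cert_def by blast
    then show ?thesis by (rule justified_mono[OF _ c']) (use * sub in blast)+
  qed
qed

text \<open>\<open>Y\<close> is available as a set before any pair is known to be decided. It is
  thus a fixed oracle in the model to which \<open>complementary\<close> applies, both in
  \<open>ex_cert\<close> and in \<open>Y_recursion\<close>.\<close>

definition Y :: "'a set" where
  "Y = {z. \<exists>n j. z = pr n j \<and> (\<exists>c d. cert (dec c) (dec d) \<and> z \<in> dec c \<and> z \<in> dec d)}"

lemma Y_in_range: "Y \<in> range S"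
  unfolding Y_def by (intro comprehension cert_intros)

lemma cert_Y:
  assumes "cert (dec c) (dec d)" "pr n j \<in> dec c" shows "pr n j \<in> Y \<longleftrightarrow> pr n j \<in> dec d"
proof
  assume "pr n j \<in> Y"
  then obtain c' d' where c': "cert (dec c') (dec d')" "pr n j \<in> dec c'" "pr n j \<in> dec d'"
    unfolding Y_def by auto
  then show "pr n j \<in> dec d"
    using cert_agree[OF assms(1) c'(1) dec_in_range dec_in_range dec_in_range dec_in_range assms(2) c'(2)]
    by simp
qed (use assms Y_def in auto)

text \<open>A collection principle: one certificate covers all queries below \<open>b\<close>. As
  \<open>b\<close> may be nonstandard, the merging is done by internal induction, with at most one
  further certificate per step.\<close>

lemma ex_cert_below:
  assumes "\<And>m a. lt X a j \<Longrightarrow> \<exists>c d. cert (dec c) (dec d) \<and> pr m a \<in> dec c"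
  shows "\<exists>c d. cert (dec c) (dec d) \<and> (\<forall>m a. pr m a \<prec> b \<and> lt X a j \<longrightarrow> pr m a \<in> dec c)"
proof (induction b rule: number_induct, intro cert_intros)
  case zero
  obtain c where "dec c = {}" using ex_code_empty by blast
  then have "cert (dec c) (dec c)" unfolding cert_def by simp
  then show ?case using not_less_zero by blast
next
  case (Suc b)
  then obtain c d where c: "cert (dec c) (dec d)"
    "\<And>m a. pr m a \<prec> b \<Longrightarrow> lt X a j \<Longrightarrow> pr m a \<in> dec c" by blast
  show ?case
  proof (cases "\<exists>m a. b = pr m a \<and> lt X a j")
    case False
    then show ?thesis using c less_Suc by metis
  next
    case True
    then obtain c' d' where c': "cert (dec c') (dec d')" "b \<in> dec c'" using assms by blast
    obtain c'' d'' where eq: "dec c'' = dec c \<union> dec c'" "dec d'' = dec d \<union> dec d'"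
      using ex_code_Un by metis
    have "cert (dec c'') (dec d'')" unfolding eq by (rule cert_Un[OF c(1) c'(1)])
    moreover have "pr m a \<in> dec c''" if "pr m a \<prec> b \<oplus> \<one>" "lt X a j" for m a
      using that c(2) c'(2) unfolding eq less_Suc by blast
    ultimately show ?thesis by blast
  qed
qed

lemma ex_cert:
  assumes "fld X j" shows "\<exists>c d. cert (dec c) (dec d) \<and> pr n j \<in> dec c"
proof -
  have "\<forall>n. \<exists>c d. cert (dec c) (dec d) \<and> pr n j \<in> dec c"
    using assms
  proof (rule wo_induct[where P = "\<lambda>j. \<forall>n. \<exists>c d. cert (dec c) (dec d) \<and> pr n j \<in> dec c", rotated -1])
    show "adef (\<lambda>e. \<forall>n. \<exists>c d. cert (dec c) (dec d) \<and> pr n (e 0) \<in> dec c)"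
      by (intro cert_intros)
    fix j assume "fld X j" and IH: "\<And>a. lt X a j \<Longrightarrow> \<forall>n. \<exists>c d. cert (dec c) (dec d) \<and> pr n a \<in> dec c"
    show "\<forall>n. \<exists>c d. cert (dec c) (dec d) \<and> pr n j \<in> dec c"
    proof
      fix n
      \<comment> \<open>Complementarity at the section of \<open>Y\<close> produces a witness; the
        induction hypothesis then certifies everything it asks.\<close>
      obtain x where x: "\<Theta> x n (sec Y j) \<or> \<Theta>' x n (sec Y j)"
        using complementary[OF sec_in_range[OF Y_in_range]] by blast
      obtain c d where c: "cert (dec c) (dec d)"
        "\<And>m a. pr m a \<prec> qbound x n \<Longrightarrow> lt X a j \<Longrightarrow> pr m a \<in> dec c"
        using ex_cert_below[of j "qbound x n"] IH by blast
      show "\<exists>c d. cert (dec c) (dec d) \<and> pr n j \<in> dec c"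
      proof (cases "pr n j \<in> dec c")
        case True
        then show ?thesis using c by blast
      next
        case False
        obtain c' where c': "dec c' = insert (pr n j) (dec c)" using ex_code_insert by blast
        \<comment> \<open>The answer at the new pair is chosen to suit the witness. Old answers stay
          as they are, since the new pair was undecided.\<close>
        obtain d' where d': "dec d' = (if \<Theta> x n (sec Y j) then insert (pr n j) (dec d) else dec d)"
          using ex_code_insert[of "pr n j" d] by (cases "\<Theta> x n (sec Y j)") auto
        have sub: "dec d \<subseteq> dec c" using c(1) unfolding cert_def by blast
        have same: "z \<in> dec d' \<longleftrightarrow> z \<in> dec d" if "z \<in> dec c" for z
          using that False d' by (auto split: if_splits)
        have "pr m a \<in> dec d' \<longleftrightarrow> pr m a \<in> Y" if "pr m a \<prec> qbound x n" "lt X a j" for m a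
          \<comment> \<open>On the queries of \<open>x\<close> the old answers coincide with
            \<open>Y\<close>, so the witness found for \<open>sec Y j\<close> also serves the new
            certificate.\<close>
          using same cert_Y[OF c(1)] c(2)[OF that] by blast
        note agree = witness_agree[OF this]
        have "pr n j \<in> dec d' \<longleftrightarrow> \<Theta> x n (sec Y j)"
          using False sub d' by auto
        then have "pr n j \<in> dec d' \<and> \<Theta> x n (sec (dec d') j) \<or>
            pr n j \<notin> dec d' \<and> \<Theta>' x n (sec (dec d') j)"
          using x by (simp only: agree) blast
        moreover have "\<forall>m a. pr m a \<prec> qbound x n \<and> lt X a j \<longrightarrow> pr m a \<in> dec c'"
          using c(2) unfolding c' by blast
        ultimately have new: "justified (dec c') (dec d') n j"
          unfolding justified_def by blast
        have old: "justified (dec c') (dec d') m a" if ma: "pr m a \<in> dec c" for m a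
        proof -
          have "justified (dec c) (dec d) m a" using c(1) ma unfolding cert_def by blast
          then show ?thesis by (rule justified_mono[OF _ ma]) (use same c' in auto)
        qed
        have "cert (dec c') (dec d')"
          unfolding cert_def
        proof (intro conjI allI impI)
          show "z \<in> dec c'" if "z \<in> dec d'" for z
            using that sub d' c' by (auto split: if_splits)
          fix m a assume "pr m a \<in> dec c'"
          then consider "m = n" "a = j" | "pr m a \<in> dec c" using c' by auto
          then show "fld X a" "justified (dec c') (dec d') m a"
            using new old \<open>fld X j\<close> c(1) unfolding cert_def by (cases; blast)+
        qed
        then show ?thesis using c' by blast
      qed
    qed
  qed
  then show ?thesis by blast
qed

text \<open>Every pair over the field has a certificate, and its witness carries over to the section
  of \<open>Y\<close>; a negative witness excludes a positive one by complementarity.\<close>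

lemma Y_recursion:
  "z \<in> Y \<longleftrightarrow> (\<exists>n j. z = pr n j \<and> fld X j \<and> (\<exists>x. \<Theta> x n (sec Y j)))"
proof -
  have "pr n j \<in> Y \<longleftrightarrow> (\<exists>x. \<Theta> x n (sec Y j))" if "fld X j" for n j
  proof -
    from ex_cert[OF that] obtain c d where c: "cert (dec c) (dec d)" "pr n j \<in> dec c" by blast
    then have "justified (dec c) (dec d) n j" unfolding cert_def by blast
    then obtain x where x: "\<And>m a. pr m a \<prec> qbound x n \<Longrightarrow> lt X a j \<Longrightarrow> pr m a \<in> dec c"
      "pr n j \<in> dec d \<and> \<Theta> x n (sec (dec d) j) \<or> pr n j \<notin> dec d \<and> \<Theta>' x n (sec (dec d) j)"
      unfolding justified_def by blast
    have "pr m a \<in> dec d \<longleftrightarrow> pr m a \<in> Y" if "pr m a \<prec> qbound x n" "lt X a j" for m a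
      using cert_Y[OF c(1) x(1)[OF that]] by blast
    note agree = witness_agree[OF this]
    have "pr n j \<in> Y \<and> \<Theta> x n (sec Y j) \<or> pr n j \<notin> Y \<and> \<Theta>' x n (sec Y j)"
      using x(2) by (simp only: agree cert_Y[OF c])
    then show ?thesis
      using complementary[OF sec_in_range[OF Y_in_range], of n j] by blast
  qed
  moreover have "\<exists>n j. z = pr n j \<and> fld X j" if "z \<in> Y"
    using that unfolding Y_def cert_def by blast
  ultimately show ?thesis by blast
qed

end

section \<open>Translation to the formal scheme\<close>

context aca_model
begin

lemma sat_ETR:
  assumes "Sigma01 \<phi>" "Sigma01 \<psi>"
  shows "sat \<eta> (\<lambda>i. S (\<rho> i)) (ETR \<phi> \<psi>)"
proof -
  obtain \<theta> \<theta>' where \<theta>: "Delta00 \<theta>" "\<phi> = ExN \<theta>" "Delta00 \<theta>'" "\<psi> = ExN \<theta>'"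
    using assms unfolding Sigma01_def by blast
  have "\<exists>k. sat \<eta> (case_nat (S k) (case_nat (S l) (\<lambda>i. S (\<rho> i)))) (H \<phi>)"
    if WO: "sat \<eta> (case_nat (S l) (\<lambda>i. S (\<rho> i))) (WO 0)"
      and compl: "\<forall>m n. sat (case_nat n \<eta>) (case_nat (S m) (case_nat (S l) (\<lambda>i. S (\<rho> i)))) \<phi>
        \<longleftrightarrow> \<not> sat (case_nat n \<eta>) (case_nat (S m) (case_nat (S l) (\<lambda>i. S (\<rho> i)))) \<psi>" for l
  proof -
    define r where "r Z = case_nat Z (case_nat (S l) (\<lambda>i. S (\<rho> i)))" for Z
    define W where "W A x n Z = sat (case_nat x (case_nat n \<eta>)) (r Z) A" for A x n Z
    obtain s s' where
      s: "\<And>\<eta> r r'. (\<forall>z. z \<prec> ev \<eta> s \<longrightarrow> (z \<in> r 0 \<longleftrightarrow> z \<in> r' 0)) \<Longrightarrow> (\<forall>i. r (Suc i) = r' (Suc i)) \<Longrightarrow>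
        sat \<eta> r \<theta> \<longleftrightarrow> sat \<eta> r' \<theta>" and
      s': "\<And>\<eta> r r'. (\<forall>z. z \<prec> ev \<eta> s' \<longrightarrow> (z \<in> r 0 \<longleftrightarrow> z \<in> r' 0)) \<Longrightarrow> (\<forall>i. r (Suc i) = r' (Suc i)) \<Longrightarrow>
        sat \<eta> r \<theta>' \<longleftrightarrow> sat \<eta> r' \<theta>'"
      using Delta00_use[OF \<theta>(1)] Delta00_use[OF \<theta>(3)] by metis
    \<comment> \<open>The sum dominates both use terms, so a single bound serves \<phi> and
      \<psi>.\<close>
    define us where "us x n = ev (case_nat x (case_nat n \<eta>)) (Add s s')" for x n
    have adef_W: "adef (\<lambda>e. W A (f e) (g e) (R e))"
      if "Delta00 A" "tdef f" "tdef g" "adef (\<lambda>e. e 0 \<in> R (\<lambda>k. e (Suc k)))" for A f g R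
      unfolding W_def
    proof (rule adef_sat[OF Delta00_arithmetical[OF that(1)]])
      show "tdef (\<lambda>e. case_nat (f e) (case_nat (g e) \<eta>) i)" for i
        by (intro tdef_case tdef_const that)
      show "adef (\<lambda>e. e 0 \<in> r (R (\<lambda>k. e (Suc k))) i)" for i
      proof (cases i)
        case 0
        then show ?thesis using that(4) by (simp add: r_def)
      next
        case (Suc i')
        \<comment> \<open>Apart from the oracle, set variables denote the order or a parameter, both
          sets of the model.\<close>
        have "r Z (Suc i') = S (case_nat l \<rho> i')" for Z
          by (simp add: r_def split: nat.split)
        then show ?thesis using Suc by (simp add: adef_mem tdef_var)
      qed
    qed
    interpret etr_model zero one add mul less S name "S l" "W \<theta>" "W \<theta>'" us
    proof
      show "S l \<in> range S" by simp
      show "P j" if "adef (\<lambda>e. P (e 0))" "\<And>j. fld (S l) j \<Longrightarrow> (\<And>a. lt (S l) a j \<Longrightarrow> P a) \<Longrightarrow> P j"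
        "fld (S l) j" for P j
        by (rule transfinite_induct[OF WO _ _ that]) auto
      show "tdef (\<lambda>e. us (f e) (g e))" if "tdef f" "tdef g" for f g
        unfolding us_def by (intro tdef_ev tdef_case tdef_const that)
      have us: "z \<prec> us x n" if "z \<prec> ev (case_nat x (case_nat n \<eta>)) s \<or> z \<prec> ev (case_nat x (case_nat n \<eta>)) s'" for x n z
        using that less_leq_trans leq_add unfolding us_def by auto
      show "W \<theta> x n Z \<longleftrightarrow> W \<theta> x n Z'" if "\<And>z. z \<prec> us x n \<Longrightarrow> z \<in> Z \<longleftrightarrow> z \<in> Z'" for x n Z Z'
        unfolding W_def by (rule s) (use that us in \<open>auto simp: r_def\<close>)
      show "W \<theta>' x n Z \<longleftrightarrow> W \<theta>' x n Z'" if "\<And>z. z \<prec> us x n \<Longrightarrow> z \<in> Z \<longleftrightarrow> z \<in> Z'" for x n Z Z'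
        unfolding W_def by (rule s') (use that us in \<open>auto simp: r_def\<close>)
      show "(\<exists>x. W \<theta> x n Z) \<longleftrightarrow> \<not> (\<exists>x. W \<theta>' x n Z)" if "Z \<in> range S" for n Z
        using that compl unfolding W_def r_def \<theta>(2,4) by auto
    qed (auto intro: adef_W \<theta>)
    obtain k where k: "S k = Y" using Y_in_range by blast
    have LO: "sat \<eta> (r Y) (LO 1)"
      using WO sat_LO_cong[of "case_nat (S l) (\<lambda>i. S (\<rho> i))" 0 "r Y" 1 \<eta> \<eta>] unfolding WO_def by (simp add: r_def)
    have is_sec: "sat \<eta>' (case_nat (S m) (r Y)) (is_section 2 1 (Var 0) 0) \<longleftrightarrow> S m = sec Y (\<eta>' 0)" for \<eta>' m
      by (auto simp: is_section_def Let_def numeral_2_eq_2 r_def sec_def)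
    have \<phi>: "sat (case_nat j (case_nat n (case_nat z \<eta>))) (case_nat Z (r Y))
        (subst (case_nat (Var 1) (\<lambda>i. Var (i + 3))) (case_nat 0 (\<lambda>i. i + 2)) \<phi>) \<longleftrightarrow> (\<exists>x. W \<theta> x n Z)" for j n z Z
    proof -
      \<comment> \<open>Undoes the renaming in \<open>H\<close>: the number parameters lie behind z,
        n and j, and the variable of the solution is skipped, so that \<phi> sees Z, the order and
        the parameters.\<close>
      have "(\<lambda>i. ev (case_nat j (case_nat n (case_nat z \<eta>))) (case_nat (Var 1) (\<lambda>i. Var (i + 3)) i)) = case_nat n \<eta>"
        by (auto simp: fun_eq_iff numeral_3_eq_3 split: nat.split)
      moreover have "(\<lambda>i. case_nat Z (r Y) (case_nat 0 (\<lambda>i. i + 2) i)) = r Z"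
        by (auto simp: fun_eq_iff numeral_2_eq_2 r_def split: nat.split)
      ultimately show ?thesis unfolding sat_subst by (simp add: \<theta>(2) W_def)
    qed
    have sec_name: "\<exists>m. S m = sec Y j" for j
      using sec_in_range[OF Y_in_range, of j] by (metis rangeE)
    \<comment> \<open>\<open>H\<close> reaches the section through a set quantifier. As every
      section is a set of the model, this agrees with \<open>Y_recursion\<close>.\<close>
    have "x \<in> Y \<longleftrightarrow> (\<exists>n j. x = pr n j \<and> fld (S l) j \<and> (\<exists>m. S m = sec Y j \<and> (\<exists>x. W \<theta> x n (S m))))" for x
      unfolding Y_recursion[of x] using sec_name by metis
    then have "sat \<eta> (r Y) (H \<phi>)"
      using LO unfolding H_def Let_def sat.simps is_sec \<phi>
      by (simp add: r_def numeral_2_eq_2) blast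
    then show ?thesis unfolding r_def k[symmetric] by blast
  qed
  then show ?thesis unfolding ETR_def by (simp only: sat.simps) blast
qed

end

theorem proposition6p13:
  fixes \<phi> \<psi> :: fm
  assumes "Sigma01 \<phi>" and "Sigma01 \<psi>"
  shows "ACA0 \<turnstile> ETR \<phi> \<psi>"
proof (rule ccontr)
  assume "\<not> ACA0 \<turnstile> ETR \<phi> \<psi>"
  moreover have "basic_axioms \<subseteq> ACA0" unfolding ACA0_def by blast
  ultimately obtain zero one :: nat and add mul less S where
    ax: "\<And>B \<eta> \<rho>. B \<in> ACA0 \<Longrightarrow> so_structure.sat zero one add mul less S \<eta> (\<lambda>i. S (\<rho> i)) B" and
    not: "\<exists>\<eta> \<rho>. \<not> so_structure.sat zero one add mul less S \<eta> (\<lambda>i. S (\<rho> i)) (ETR \<phi> \<psi>)"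
    using completeness by metis
  interpret aca_model zero one add mul less S id
    by standard (auto intro: ax)
  show False using not sat_ETR[OF assms] by blast
qed

end
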